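(* Let $G$ be a simple graph, let $l$ be a nonincreasing intersecting supermodular nonnegative integer-valued function on subsets of $V(G)$, and let $p$ and $k$ be positive integers with $k\ge 2$. Suppose that $G$ is $(4kp-2p+2l)$-connected, i.e. for any two disjoint vertex sets $A,B\subseteq V(G)$ with $A\neq\emptyset$ and $A\cup B\subsetneq V(G)$, $$d_{G-B}(A)\ge 4kp-2p+2l(A\cup B)-|B|.$$ Then $G$ has a packing (a collection of pairwise edge-disjoint subgraphs) consisting of one spanning $l$-partition-connected subgraph and $p$ spanning $k$-rigid subgraphs.
   Context: Graphs are finite and loopless; multiple edges are allowed unless the graph is called simple. For $X\subseteq V(G)$, $d_G(X)$ is the number of edges with exactly one end in $X$, $e_G(X)$ the number of edges with both ends in $X$, and $G-B$ is obtained by deleting the vertices of $B$. For a partition $P$ of $V(G)$, $e_G(P)$ is the number of edges joining different parts of $P$. Set functions on subsets of $V(G)$ are zero on $\emptyset$; write $l(v)=l(\{v\})$ and $l(G)=l(V(G))$. A set function $l$ is intersecting supermodular if $l(A\cap B)+l(A\cup B)\ge l(A)+l(B)$ for all $A,B$ with $A\cap B\neq\emptyset$; it is nonincreasing if $l(A)\ge l(B)$ for all nonempty $A\subseteq B$. A graph $H$ is $l$-partition-connected if $e_H(P)\ge\sum_{A\in P}l(A)-l(V(H))$ for every partition $P$ of $V(H)$. For a set function $\ell$, a spanning subgraph $F$ of $H$ is $\ell$-sparse if $e_F(A)\le\sum_{v\in A}\ell(v)-\ell(A)$ for all $A\subseteq V(H)$, and $H$ is $\ell$-rigid if it has a spanning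 $\ell$-sparse subgraph $F$ with $|E(F)|=\sum_{v\in V(H)}\ell(v)-\ell(V(H))$. For an integer $k$, $k$-rigid means $\ell_{k,2k-1}$-rigid, where $\ell_{k,2k-1}$ is $0$ on $\emptyset$, $k$ on singletons and $2k-1$ on sets of at least two vertices. *)

theory Defs
  imports Main "HOL-Library.Disjoint_Sets"
begin

text \<open>Every spanning subgraph of a simple graph is simple, so edges are represented throughout as
  two-element sets of vertices.\<close>

record 'a sgraph =
  verts :: "'a set"
  edges :: "'a set set"

definition simple_graph :: "'a sgraph \<Rightarrow> bool" where
  "simple_graph G \<longleftrightarrow> finite (verts G) \<and> (\<forall>e\<in>edges G. e \<subseteq> verts G \<and> card e = 2)"

definition spanning_subgraph :: "'a sgraph \<Rightarrow> 'a sgraph \<Rightarrow> bool" where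
  "spanning_subgraph F H \<longleftrightarrow> verts F = verts H \<and> edges F \<subseteq> edges H"

definition delete_verts :: "'a sgraph \<Rightarrow> 'a set \<Rightarrow> 'a sgraph" where
  "delete_verts G B = \<lparr>verts = verts G - B, edges = {e \<in> edges G. e \<inter> B = {}}\<rparr>"

definition cut_degree :: "'a sgraph \<Rightarrow> 'a set \<Rightarrow> nat" where
  "cut_degree G X = card {e \<in> edges G. card (e \<inter> X) = 1}"

definition num_edges_within :: "'a sgraph \<Rightarrow> 'a set \<Rightarrow> nat" where
  "num_edges_within G X = card {e \<in> edges G. e \<subseteq> X}"

definition num_edges_across :: "'a sgraph \<Rightarrow> 'a set set \<Rightarrow> nat" where
  "num_edges_across G P =
     card {e \<in> edges G. \<exists>A\<in>P. \<exists>B\<in>P. A \<noteq> B \<and> e \<inter> A \<noteq> {} \<and> e \<inter> B \<noteq> {}}"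

definition intersecting_supermodular_on :: "'a set \<Rightarrow> ('a set \<Rightarrow> int) \<Rightarrow> bool" where
  "intersecting_supermodular_on V l \<longleftrightarrow>
     (\<forall>A B. A \<subseteq> V \<and> B \<subseteq> V \<and> A \<inter> B \<noteq> {} \<longrightarrow> l (A \<inter> B) + l (A \<union> B) \<ge> l A + l B)"

definition nonincreasing_on :: "'a set \<Rightarrow> ('a set \<Rightarrow> int) \<Rightarrow> bool" where
  "nonincreasing_on V l \<longleftrightarrow>
     (\<forall>A B. A \<noteq> {} \<and> A \<subseteq> B \<and> B \<subseteq> V \<longrightarrow> l A \<ge> l B)"

definition partition_connected :: "('a set \<Rightarrow> int) \<Rightarrow> 'a sgraph \<Rightarrow> bool" where
  "partition_connected l H \<longleftrightarrow>
     (\<forall>P. partition_on (verts H) P \<longrightarrow>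
        int (num_edges_across H P) \<ge> (\<Sum>A\<in>P. l A) - l (verts H))"

definition sparse :: "('a set \<Rightarrow> int) \<Rightarrow> 'a sgraph \<Rightarrow> bool" where
  "sparse l F \<longleftrightarrow>
     (\<forall>A. A \<subseteq> verts F \<longrightarrow> int (num_edges_within F A) \<le> (\<Sum>v\<in>A. l {v}) - l A)"

definition rigid :: "('a set \<Rightarrow> int) \<Rightarrow> 'a sgraph \<Rightarrow> bool" where
  "rigid l H \<longleftrightarrow>
     (\<exists>F. spanning_subgraph F H \<and> sparse l F \<and>
        int (card (edges F)) = (\<Sum>v\<in>verts H. l {v}) - l (verts H))"

definition ell :: "int \<Rightarrow> int \<Rightarrow> 'a set \<Rightarrow> int" where
  "ell k m X = (if X = {} then 0 else if card X = 1 then k else m)"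

definition k_rigid :: "int \<Rightarrow> 'a sgraph \<Rightarrow> bool" where
  "k_rigid k H \<longleftrightarrow> rigid (ell k (2 * k - 1)) H"

end

theory Submission
  imports Defs
begin

text \<open>
  A maximal colouring of the edges by one \<open>l\<close>-sparse class and
  \<open>p\<close> classes sparse for \<open>ell k (2k-1)\<close> is analysed by exchanging a coloured edge against an
  uncoloured one. Let \<open>F\<close> consist of the edges that become uncoloured after some sequence of
  exchanges. Uncrossing tight sets shows that each edge of \<open>F\<close> lies, for every colour, in a set that
  is tight for the part of the colour class inside \<open>F\<close>. The maximal tight sets form a partition \<open>P\<close>
  of the vertices for the first colour, and for the others a family \<open>H\<close> whose members each lie
  inside a part of \<open>P\<close>. Members with fewer than \<open>2k\<close> vertices can be dropped, because a simple graph
  has few edges on them.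

  If \<open>X \<in> H\<close> has a vertex in no other member, the connectivity assumption, applied to these private
  vertices after deleting the rest \<open>B\<close> of \<open>X\<close>, yields \<open>4kp - 2p + 2 l X - card B\<close> edges outside \<open>F\<close>,
  while the vertices of \<open>B\<close> are counted at least twice in the sum of the cardinalities of the members
  of \<open>H\<close>. Adding this up, all colour classes must have full size, and a full \<open>l\<close>-sparse class is
  \<open>l\<close>-partition-connected.
\<close>

section \<open>Tight sets and exchanges\<close>

text \<open>The right-hand side of the sparsity condition. Supermodularity of \<open>l\<close> on
  intersecting pairs becomes submodularity of \<open>excess l\<close>, the form in which uncrossing
  uses it.\<close>

definition excess :: "('a set \<Rightarrow> int) \<Rightarrow> 'a set \<Rightarrow> int" where
  "excess l X = (\<Sum>v\<in>X. l {v}) - l X"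

definition sparse_edges :: "'a set \<Rightarrow> ('a set \<Rightarrow> int) \<Rightarrow> 'a set set \<Rightarrow> bool" where
  "sparse_edges V l J \<longleftrightarrow> (\<forall>X\<subseteq>V. int (card {e \<in> J. e \<subseteq> X}) \<le> excess l X)"

definition tight :: "('a set \<Rightarrow> int) \<Rightarrow> 'a set set \<Rightarrow> 'a set \<Rightarrow> bool" where
  "tight l J X \<longleftrightarrow> int (card {e \<in> J. e \<subseteq> X}) = excess l X"

lemma sparse_edges_mono:
  assumes "sparse_edges V l J" "K \<subseteq> J" "finite J"
  shows "sparse_edges V l K"
  unfolding sparse_edges_def
proof (intro allI impI)
  fix X assume "X \<subseteq> V"
  have "card {e \<in> K. e \<subseteq> X} \<le> card {e \<in> J. e \<subseteq> X}"
    by (rule card_mono) (use assms in auto)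
  moreover have "int (card {e \<in> J. e \<subseteq> X}) \<le> excess l X"
    using assms(1) \<open>X \<subseteq> V\<close> unfolding sparse_edges_def by blast
  ultimately show "int (card {e \<in> K. e \<subseteq> X}) \<le> excess l X" by linarith
qed

text \<open>The number of edges inside a set is supermodular and bounded by \<open>excess l\<close>,
  which is submodular on this pair. Equality at \<open>X\<close> and \<open>Y\<close> therefore
  forces equality at the intersection and at the union.\<close>

lemma tight_Int_Un:
  assumes "finite J" "sparse_edges V l J" "X \<subseteq> V" "Y \<subseteq> V"
    and "tight l J X" "tight l J Y"
    and sub: "excess l (X \<inter> Y) + excess l (X \<union> Y) \<le> excess l X + excess l Y"
  shows "tight l J (X \<inter> Y)" "tight l J (X \<union> Y)"
proof -
  let ?i = "\<lambda>X. {e \<in> J. e \<subseteq> X}"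
  have "card (?i X) + card (?i Y) = card (?i X \<union> ?i Y) + card (?i X \<inter> ?i Y)"
    by (rule card_Un_Int) (use assms in auto)
  moreover have "?i X \<inter> ?i Y = ?i (X \<inter> Y)" by auto
  moreover have "card (?i X \<union> ?i Y) \<le> card (?i (X \<union> Y))"
    by (rule card_mono) (use assms in auto)
  moreover have "int (card (?i (X \<inter> Y))) \<le> excess l (X \<inter> Y)" "int (card (?i (X \<union> Y))) \<le> excess l (X \<union> Y)"
    using assms unfolding sparse_edges_def by blast+
  ultimately show "tight l J (X \<inter> Y)" "tight l J (X \<union> Y)"
    using sub assms(5,6) unfolding tight_def by auto
qed

lemma tight_superset_edges:
  assumes "tight l K X" "K \<subseteq> J" "finite J" "sparse_edges V l J" "X \<subseteq> V"
  shows "tight l J X"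
proof -
  have "card {e \<in> K. e \<subseteq> X} \<le> card {e \<in> J. e \<subseteq> X}"
    by (rule card_mono) (use assms in auto)
  moreover have "int (card {e \<in> J. e \<subseteq> X}) \<le> excess l X"
    using assms(4,5) unfolding sparse_edges_def by blast
  ultimately show ?thesis using assms(1) unfolding tight_def by linarith
qed

text \<open>The family consists of the maximal tight sets with at least \<open>s\<close> vertices.
  For \<open>s = 1\<close> they are pairwise disjoint, for \<open>s = 2\<close> two of them share at
  most one vertex. As \<open>s \<le> 2\<close>, no edge lies in two members, so the excesses, being
  edge counts of the members, add up to at most \<open>card J\<close>.\<close>

lemma maximal_tight_family:
  assumes "finite V" "finite J" "sparse_edges V l J" "s \<le> 2"
    and edge: "\<And>e. e \<in> J \<Longrightarrow> card e = 2"
    and sub: "\<And>X Y. X \<subseteq> V \<Longrightarrow> Y \<subseteq> V \<Longrightarrow> s \<le> card (X \<inter> Y) \<Longrightarrow>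
      excess l (X \<inter> Y) + excess l (X \<union> Y) \<le> excess l X + excess l Y"
  obtains H where "\<And>X. X \<in> H \<Longrightarrow> X \<subseteq> V \<and> s \<le> card X \<and> tight l J X"
    and "\<And>X. X \<subseteq> V \<Longrightarrow> s \<le> card X \<Longrightarrow> tight l J X \<Longrightarrow> \<exists>Y\<in>H. X \<subseteq> Y"
    and "\<And>X Y. X \<in> H \<Longrightarrow> Y \<in> H \<Longrightarrow> X \<noteq> Y \<Longrightarrow> card (X \<inter> Y) < s"
    and "(\<Sum>X\<in>H. excess l X) \<le> int (card J)"
proof -
  define T where "T = {X. X \<subseteq> V \<and> s \<le> card X \<and> tight l J X}"
  define H where "H = {X \<in> T. \<forall>Y\<in>T. X \<subseteq> Y \<longrightarrow> X = Y}"
  have finT: "finite T" unfolding T_def using assms(1) by simp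
  have H1: "X \<subseteq> V \<and> s \<le> card X \<and> tight l J X" if "X \<in> H" for X
    using that unfolding H_def T_def by auto
  have H2: "\<exists>Y\<in>H. X \<subseteq> Y" if "X \<subseteq> V" "s \<le> card X" "tight l J X" for X
  proof -
    have "X \<in> T" using that T_def by auto
    from finite_has_maximal2[OF finT this] obtain Y where "Y \<in> T" "X \<subseteq> Y" "\<forall>b\<in>T. Y \<subseteq> b \<longrightarrow> Y = b"
      by blast
    then show ?thesis unfolding H_def by blast
  qed
  have H3: "card (X \<inter> Y) < s" if XY: "X \<in> H" "Y \<in> H" "X \<noteq> Y" for X Y
  proof (rule ccontr)
    assume n: "\<not> card (X \<inter> Y) < s"
    have V: "X \<subseteq> V" "Y \<subseteq> V" using H1 XY by auto
    have "tight l J (X \<union> Y)"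
      using tight_Int_Un(2)[OF assms(2,3) V] sub[OF V] H1 XY n by auto
    moreover have "s \<le> card (X \<union> Y)"
    proof -
      have "finite (X \<union> Y)" using V assms(1) finite_subset by blast
      then have "card X \<le> card (X \<union> Y)" by (rule card_mono) auto
      then show ?thesis using H1[OF XY(1)] by linarith
    qed
    ultimately have "X \<union> Y \<in> T" using V unfolding T_def by auto
    moreover have "\<forall>Z\<in>T. X \<subseteq> Z \<longrightarrow> X = Z" "\<forall>Z\<in>T. Y \<subseteq> Z \<longrightarrow> Y = Z" using XY(1,2) unfolding H_def by auto
    ultimately have "X = X \<union> Y" "Y = X \<union> Y" by simp_all
    with XY(3) show False by simp
  qed
  have finH: "finite H" using finT unfolding H_def by simp
  have "(\<Sum>X\<in>H. excess l X) = (\<Sum>X\<in>H. int (card {e \<in> J. e \<subseteq> X}))"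
    by (rule sum.cong) (use H1 in \<open>auto simp: tight_def\<close>)
  also have "\<dots> = int (card (\<Union>X\<in>H. {e \<in> J. e \<subseteq> X}))"
  proof (subst card_UN_disjoint)
    show "\<forall>X\<in>H. \<forall>Y\<in>H. X \<noteq> Y \<longrightarrow> {e \<in> J. e \<subseteq> X} \<inter> {e \<in> J. e \<subseteq> Y} = {}"
    proof (intro ballI impI, rule ccontr)
      fix X Y assume XY: "X \<in> H" "Y \<in> H" "X \<noteq> Y" and "{e \<in> J. e \<subseteq> X} \<inter> {e \<in> J. e \<subseteq> Y} \<noteq> {}"
      then obtain e where "e \<in> J" "e \<subseteq> X \<inter> Y" by auto
      moreover have "finite (X \<inter> Y)" using H1[OF XY(1)] assms(1) finite_subset by blast
      ultimately have "2 \<le> card (X \<inter> Y)" using edge[of e] card_mono[of "X \<inter> Y" e] by simp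
      with H3[OF XY] assms(4) show False by simp
    qed
  qed (use finH assms in auto)
  also have "\<dots> \<le> int (card J)"
    using card_mono[OF assms(2), of "\<Union>X\<in>H. {e \<in> J. e \<subseteq> X}"] by auto
  finally show ?thesis using that[of H] H1 H2 H3 by blast
qed

section \<open>Optimal colourings and exchanges\<close>

locale sparse_colouring =
  fixes V :: "'a set" and E :: "'a set set" and N :: nat and l :: "nat \<Rightarrow> 'a set \<Rightarrow> int"
  assumes finV: "finite V"
    and edgeE: "\<And>e. e \<in> E \<Longrightarrow> e \<subseteq> V \<and> card e = 2"
    and sub: "\<And>i X Y. i < N \<Longrightarrow> X \<subseteq> V \<Longrightarrow> Y \<subseteq> V \<Longrightarrow> 2 \<le> card (X \<inter> Y) \<Longrightarrow>
      excess (l i) (X \<inter> Y) + excess (l i) (X \<union> Y) \<le> excess (l i) X + excess (l i) Y"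
    and nonneg: "\<And>i X. i < N \<Longrightarrow> X \<subseteq> V \<Longrightarrow> 0 \<le> excess (l i) X"
begin

text \<open>A colouring uses the colours below \<open>N\<close>; any larger value marks an uncoloured edge.\<close>

definition colour_class :: "('a set \<Rightarrow> nat) \<Rightarrow> nat \<Rightarrow> 'a set set" where
  "colour_class c i = {e \<in> E. c e = i}"

definition valid :: "('a set \<Rightarrow> nat) \<Rightarrow> bool" where
  "valid c \<longleftrightarrow> (\<forall>i<N. sparse_edges V (l i) (colour_class c i))"

definition coloured :: "('a set \<Rightarrow> nat) \<Rightarrow> 'a set set" where
  "coloured c = {e \<in> E. c e < N}"

definition optimal :: "('a set \<Rightarrow> nat) \<Rightarrow> bool" where
  "optimal c \<longleftrightarrow> valid c \<and> (\<forall>c'. valid c' \<longrightarrow> card (coloured c') \<le> card (coloured c))"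

text \<open>One step of an augmentation in the style of matroid union: the colour of
  \<open>f\<close> passes to the uncoloured edge \<open>e\<close>, so the number of coloured edges
  is preserved.\<close>

definition exchange :: "('a set \<Rightarrow> nat) \<Rightarrow> ('a set \<Rightarrow> nat) \<Rightarrow> bool" where
  "exchange c c' \<longleftrightarrow> valid c' \<and>
     (\<exists>e\<in>E. \<exists>f\<in>E. N \<le> c e \<and> c f < N \<and> c' = c(e := c f, f := N))"

text \<open>The set \<open>F\<close> of the introduction. Sequences of length zero count, so an edge
  of \<open>E\<close> outside this set is coloured by \<open>c\<close> itself.\<close>

definition freeable :: "('a set \<Rightarrow> nat) \<Rightarrow> 'a set set" where
  "freeable c = {e \<in> E. \<exists>c'. exchange\<^sup>*\<^sup>* c c' \<and> N \<le> c' e}"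

lemma finE: "finite E"
  by (rule finite_subset[of _ "Pow V"]) (use finV edgeE in auto)

lemma fin_class: "finite (colour_class c i)"
  using finE unfolding colour_class_def by simp

lemma optimal_exists: "\<exists>c. optimal c"
proof -
  \<comment> \<open>The value \<open>N\<close> leaves every edge uncoloured, and empty classes are
    sparse because excesses are nonnegative.\<close>
  have "valid (\<lambda>_. N)"
    unfolding valid_def sparse_edges_def colour_class_def using nonneg by auto
  moreover have "card (coloured c) < Suc (card E)" for c
    using card_mono[OF finE, of "coloured c"] unfolding coloured_def by auto
  ultimately show ?thesis
    unfolding optimal_def
    using ex_has_greatest_nat[of valid "\<lambda>_. N" "\<lambda>c. card (coloured c)" "Suc (card E)"] by (meson less_imp_le)
qed

lemma exchange_optimal:
  assumes "optimal c" "exchange c c'"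
  shows "optimal c'"
proof -
  from assms(2) obtain e f where ef: "e \<in> E" "f \<in> E" "N \<le> c e" "c f < N" "c' = c(e := c f, f := N)"
    and v: "valid c'" unfolding exchange_def by blast
  have "e \<noteq> f" using ef by auto
  then have "coloured c' = insert e (coloured c - {f})"
    using ef unfolding coloured_def by auto
  moreover have "e \<notin> coloured c" "f \<in> coloured c" "finite (coloured c)"
    using ef finE unfolding coloured_def by auto
  ultimately have "card (coloured c') = card (coloured c)"
    by (metis Diff_iff card.remove card_insert_disjoint finite_Diff)
  with v assms(1) show ?thesis unfolding optimal_def by simp
qed

lemma reachable_optimal: "exchange\<^sup>*\<^sup>* c c' \<Longrightarrow> optimal c \<Longrightarrow> optimal c'"
  by (induction rule: rtranclp_induct) (auto intro: exchange_optimal)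

text \<open>By optimality \<open>e\<close> cannot receive colour \<open>i\<close>, so it lies in a
  set tight for this class. Let \<open>T\<close> be the least such set: exchanging \<open>e\<close>
  against any class edge inside \<open>T\<close> preserves sparsity, hence all these edges are
  freeable and \<open>T\<close> stays tight when the class is restricted to
  \<open>freeable c\<close>.\<close>

lemma uncoloured_in_tight:
  assumes "optimal c" and reach: "exchange\<^sup>*\<^sup>* c c'" and e: "e \<in> E" "N \<le> c' e" and i: "i < N"
  obtains T where "T \<subseteq> V" "e \<subseteq> T" "tight (l i) (colour_class c' i \<inter> freeable c) T"
proof -
  have opt: "optimal c'" using reachable_optimal assms by blast
  let ?J = "colour_class c' i"
  have spJ: "sparse_edges V (l i) ?J" using opt i unfolding optimal_def valid_def by auto
  have eV: "e \<subseteq> V" "card e = 2" using edgeE e by auto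
  have eJ: "e \<notin> ?J" using e i unfolding colour_class_def by auto
  have "\<not> valid (c'(e := i))"
  proof
    assume "valid (c'(e := i))"
    then have "card (coloured (c'(e := i))) \<le> card (coloured c')" using opt unfolding optimal_def by auto
    moreover have "coloured (c'(e := i)) = insert e (coloured c')" "e \<notin> coloured c'" "finite (coloured c')"
      using e i finE unfolding coloured_def by auto
    ultimately show False by simp
  qed
  then obtain j where j: "j < N" "\<not> sparse_edges V (l j) (colour_class (c'(e := i)) j)"
    unfolding valid_def by blast
  have "j = i"
  proof (rule ccontr)
    assume "j \<noteq> i"
    then have "colour_class (c'(e := i)) j = colour_class c' j"
      using e j unfolding colour_class_def by auto
    then show False using j opt unfolding optimal_def valid_def by auto
  qed
  moreover have "colour_class (c'(e := i)) i = insert e ?J"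
    using e unfolding colour_class_def by auto
  \<comment> \<open>A set violated only after \<open>e\<close> joins the class must contain
    \<open>e\<close> and have been tight before.\<close>
  ultimately obtain X where X: "X \<subseteq> V" "\<not> int (card {g \<in> insert e ?J. g \<subseteq> X}) \<le> excess (l i) X"
    using j unfolding sparse_edges_def by auto
  have spX: "int (card {g \<in> ?J. g \<subseteq> X}) \<le> excess (l i) X" using spJ X unfolding sparse_edges_def by auto
  have "e \<subseteq> X"
  proof (rule ccontr)
    assume "\<not> e \<subseteq> X"
    then have "{g \<in> insert e ?J. g \<subseteq> X} = {g \<in> ?J. g \<subseteq> X}" by auto
    with X spX show False by simp
  qed
  then have "{g \<in> insert e ?J. g \<subseteq> X} = insert e {g \<in> ?J. g \<subseteq> X}" by auto
  then have "card {g \<in> insert e ?J. g \<subseteq> X} = Suc (card {g \<in> ?J. g \<subseteq> X})"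
    using eJ fin_class by auto
  then have "tight (l i) ?J X" using X spX unfolding tight_def by auto
  define TT where "TT = {X. X \<subseteq> V \<and> e \<subseteq> X \<and> tight (l i) ?J X}"
  have "X \<in> TT" using X \<open>e \<subseteq> X\<close> \<open>tight (l i) ?J X\<close> TT_def by auto
  moreover have finTT: "finite TT" unfolding TT_def using finV by simp
  ultimately obtain T where T: "T \<in> TT" "\<And>Y. Y \<in> TT \<Longrightarrow> Y \<subseteq> T \<Longrightarrow> T = Y"
    using finite_has_minimal2[OF finTT] by metis
  \<comment> \<open>Tight sets containing \<open>e\<close> meet in both ends of \<open>e\<close>, so
    they uncross and a minimal one is the least one.\<close>
  have least: "T \<subseteq> Y" if Y: "Y \<in> TT" for Y
  proof -
    have TY: "T \<subseteq> V" "Y \<subseteq> V" "e \<subseteq> T \<inter> Y" using T Y unfolding TT_def by auto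
    have "2 \<le> card (T \<inter> Y)"
      using card_mono[OF _ TY(3)] eV TY finV finite_subset by (metis finite_Int)
    then have "tight (l i) ?J (T \<inter> Y)"
      using tight_Int_Un(1)[OF fin_class spJ TY(1,2)] sub[OF i TY(1,2)] T Y unfolding TT_def by auto
    then have "T \<inter> Y \<in> TT" using TY unfolding TT_def by auto
    then show ?thesis using T(2)[of "T \<inter> Y"] by auto
  qed
  have free: "f \<in> freeable c" if f: "f \<in> ?J" "f \<subseteq> T" for f
  proof -
    let ?d = "c'(e := i, f := N)"
    have fE: "f \<in> E" "c' f = i" using f unfolding colour_class_def by auto
    have ef: "e \<noteq> f" using f eJ by auto
    have "valid ?d"
      unfolding valid_def
    proof (intro allI impI)
      fix j assume jN: "j < N"
      show "sparse_edges V (l j) (colour_class ?d j)"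
      proof (cases "j = i")
        case False
        then have "colour_class ?d j = colour_class c' j"
          using e jN fE unfolding colour_class_def by auto
        then show ?thesis using jN opt unfolding optimal_def valid_def by auto
      next
        case True
        have cl: "colour_class ?d j = insert e (?J - {f})"
          using e i fE ef True unfolding colour_class_def by auto
        have "sparse_edges V (l i) (insert e (?J - {f}))" unfolding sparse_edges_def
        proof (intro allI impI)
          fix Y assume YV: "Y \<subseteq> V"
          have spY: "int (card {g \<in> ?J. g \<subseteq> Y}) \<le> excess (l i) Y" using spJ YV unfolding sparse_edges_def by auto
          have finY: "finite {g \<in> ?J. g \<subseteq> Y}" using fin_class by auto
          show "int (card {g \<in> insert e (?J - {f}). g \<subseteq> Y}) \<le> excess (l i) Y"
          proof (cases "Y \<in> TT")
            \<comment> \<open>Such a \<open>Y\<close> contains \<open>T\<close> and thus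
              \<open>f\<close>: it gains \<open>e\<close> and loses \<open>f\<close>.\<close>
            case True
            then have "f \<subseteq> Y" "e \<subseteq> Y" using least f unfolding TT_def by auto
            then have "{g \<in> insert e (?J - {f}). g \<subseteq> Y} = insert e ({g \<in> ?J. g \<subseteq> Y} - {f})"
              and "f \<in> {g \<in> ?J. g \<subseteq> Y}" using f by auto
            then have "card {g \<in> insert e (?J - {f}). g \<subseteq> Y} = card {g \<in> ?J. g \<subseteq> Y}"
              using eJ finY by (metis (no_types, lifting) Diff_iff card.remove card_insert_disjoint finite_Diff mem_Collect_eq)
            then show ?thesis using spY by simp
          next
            case nT: False
            show ?thesis
            proof (cases "e \<subseteq> Y")
              case True
              \<comment> \<open>A set that contains \<open>e\<close> without being tight has room
                for one more edge.\<close>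
              then have "int (card {g \<in> ?J. g \<subseteq> Y}) < excess (l i) Y"
                using nT YV spY unfolding TT_def tight_def by auto
              moreover have "card {g \<in> insert e (?J - {f}). g \<subseteq> Y} \<le> card (insert e {g \<in> ?J. g \<subseteq> Y})"
                by (rule card_mono) (use finY in auto)
              moreover have "\<dots> \<le> Suc (card {g \<in> ?J. g \<subseteq> Y})" using finY by (simp add: card_insert_if)
              ultimately show ?thesis by simp
            next
              case False
              then have "card {g \<in> insert e (?J - {f}). g \<subseteq> Y} \<le> card {g \<in> ?J. g \<subseteq> Y}"
                by (intro card_mono) (use finY in auto)
              then show ?thesis using spY by simp
            qed
          qed
        qed
        then show ?thesis using cl True by simp
      qed
    qed
    then have "exchange c' ?d" unfolding exchange_def using e fE i by auto
    then have "exchange\<^sup>*\<^sup>* c ?d" using reach by auto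
    then show ?thesis unfolding freeable_def using fE by auto
  qed
  then have "{g \<in> ?J \<inter> freeable c. g \<subseteq> T} = {g \<in> ?J. g \<subseteq> T}" by auto
  then have "tight (l i) (?J \<inter> freeable c) T" using T unfolding TT_def tight_def by auto
  then show ?thesis using that T unfolding TT_def by blast
qed

text \<open>Only the class that trades \<open>f\<close> for \<open>e\<close> changes. If
  \<open>X\<close> does not contain \<open>e\<close>, the earlier class has at least as many edges
  inside \<open>X\<close>, which stays tight. Otherwise \<open>X\<close> is enlarged by a tight set
  \<open>T\<close> around \<open>e\<close>; it contains \<open>f\<close> as well, so the exchange
  leaves the count inside \<open>X \<union> T\<close> unchanged.\<close>

lemma tight_exchange_back:
  assumes opt: "optimal c" and reach: "exchange\<^sup>*\<^sup>* c c'" and step: "exchange c' c''"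
    and i: "i < N" and X: "X \<subseteq> V" "tight (l i) (colour_class c'' i \<inter> freeable c) X"
  shows "\<exists>Y\<subseteq>V. X \<subseteq> Y \<and> tight (l i) (colour_class c' i \<inter> freeable c) Y"
proof -
  from step obtain e f where ef: "e \<in> E" "f \<in> E" "N \<le> c' e" "c' f < N" "c'' = c'(e := c' f, f := N)"
    and v: "valid c''" unfolding exchange_def by blast
  have ne: "e \<noteq> f" using ef by auto
  let ?F = "freeable c"
  show ?thesis
  proof (cases "c' f = i")
    case False
    then have "colour_class c' i = colour_class c'' i"
      using ef i unfolding colour_class_def by auto
    with X show ?thesis by auto
  next
    case True
    let ?J = "colour_class c' i"
    have opt': "optimal c'" using reachable_optimal[OF reach opt] .
    have J'': "colour_class c'' i = insert e (?J - {f})"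
      using ef i True ne unfolding colour_class_def by auto
    have eJ: "e \<notin> ?J" and fJ: "f \<in> ?J" using ef i True unfolding colour_class_def by auto
    have eF: "e \<in> ?F" unfolding freeable_def using ef reach by auto
    have fF: "f \<in> ?F" unfolding freeable_def using ef reach step ne
      by (auto intro!: exI[of _ c''])
    have spJ: "sparse_edges V (l i) ?J" using opt' i unfolding optimal_def valid_def by auto
    have spJ'': "sparse_edges V (l i) (insert e (?J - {f}))" using v i J'' unfolding valid_def by metis
    obtain T where T: "T \<subseteq> V" "e \<subseteq> T" "tight (l i) (?J \<inter> ?F) T"
      using uncoloured_in_tight[OF opt reach ef(1,3) i] .
    have tJ: "tight (l i) ?J T" by (rule tight_superset_edges[OF T(3) _ _ spJ T(1)]) (use fin_class in auto)
    \<comment> \<open>Otherwise \<open>T\<close> would keep all its edges and gain \<open>e\<close>,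
      which exceeds the bound attained by the tight set \<open>T\<close>.\<close>
    have fT: "f \<subseteq> T"
    proof (rule ccontr)
      assume "\<not> f \<subseteq> T"
      then have "{g \<in> insert e (?J - {f}). g \<subseteq> T} = insert e {g \<in> ?J. g \<subseteq> T}" using T by auto
      then have "card {g \<in> insert e (?J - {f}). g \<subseteq> T} = Suc (card {g \<in> ?J. g \<subseteq> T})"
        using eJ fin_class by auto
      moreover have "int (card {g \<in> insert e (?J - {f}). g \<subseteq> T}) \<le> excess (l i) T"
        using spJ'' T unfolding sparse_edges_def by auto
      ultimately show False using tJ unfolding tight_def by auto
    qed
    have swap: "tight (l i) (colour_class c'' i \<inter> ?F) Y \<longleftrightarrow> tight (l i) (?J \<inter> ?F) Y"
      if "e \<subseteq> Y" "f \<subseteq> Y" for Y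
    proof -
      have "{g \<in> colour_class c'' i \<inter> ?F. g \<subseteq> Y} = insert e ({g \<in> ?J \<inter> ?F. g \<subseteq> Y} - {f})"
        and "f \<in> {g \<in> ?J \<inter> ?F. g \<subseteq> Y}" and "e \<notin> {g \<in> ?J \<inter> ?F. g \<subseteq> Y}"
        using that eF fF eJ fJ J'' by auto
      moreover have "finite {g \<in> ?J \<inter> ?F. g \<subseteq> Y}" using fin_class by auto
      ultimately have "card {g \<in> colour_class c'' i \<inter> ?F. g \<subseteq> Y} = card {g \<in> ?J \<inter> ?F. g \<subseteq> Y}"
        by (metis (no_types, lifting) Diff_iff card.remove card_insert_disjoint finite_Diff)
      then show ?thesis unfolding tight_def by simp
    qed
    show ?thesis
    proof (cases "e \<subseteq> X")
      case True
      have "2 \<le> card (X \<inter> T)"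
        using card_mono[of "X \<inter> T" e] True T finV finite_subset[of _ V] edgeE[OF ef(1)] by fastforce
      moreover have "sparse_edges V (l i) (colour_class c'' i \<inter> ?F)"
        by (rule sparse_edges_mono[OF spJ''[folded J'']]) (use fin_class in auto)
      ultimately have "tight (l i) (colour_class c'' i \<inter> ?F) (X \<union> T)"
        using tight_Int_Un(2)[of "colour_class c'' i \<inter> ?F" V "l i" X T] fin_class X T swap[OF T(2) fT] sub[OF i X(1) T(1)]
        by auto
      then show ?thesis using swap[of "X \<union> T"] X T fT by (intro exI[of _ "X \<union> T"]) auto
    next
      case False
      have "card {g \<in> colour_class c'' i \<inter> ?F. g \<subseteq> X} \<le> card {g \<in> ?J \<inter> ?F. g \<subseteq> X}"
        by (rule card_mono) (use fin_class False J'' in auto)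
      moreover have "sparse_edges V (l i) (?J \<inter> ?F)"
        by (rule sparse_edges_mono[OF spJ]) (use fin_class in auto)
      then have "int (card {g \<in> ?J \<inter> ?F. g \<subseteq> X}) \<le> excess (l i) X"
        using X(1) unfolding sparse_edges_def by blast
      ultimately have "tight (l i) (?J \<inter> ?F) X" using X(2) unfolding tight_def by linarith
      with X show ?thesis by auto
    qed
  qed
qed

lemma tight_reachable_back:
  assumes opt: "optimal c" and i: "i < N" and reach: "exchange\<^sup>*\<^sup>* c c'"
    and "X \<subseteq> V" "tight (l i) (colour_class c' i \<inter> freeable c) X"
  shows "\<exists>Y\<subseteq>V. X \<subseteq> Y \<and> tight (l i) (colour_class c i \<inter> freeable c) Y"
  using reach assms(4,5)
proof (induction arbitrary: X rule: rtranclp_induct)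
  case base
  then show ?case by blast
next
  case (step c' c'')
  from tight_exchange_back[OF opt step.hyps(1,2) i step.prems] step.IH show ?case
    by (meson subset_trans)
qed

text \<open>With \<open>F = freeable c\<close>, every edge of \<open>F\<close> is uncoloured in some
  reachable colouring. The tight set found there is pulled back, one exchange at a time, to a larger
  set tight for \<open>c\<close>.\<close>

theorem sparse_packing_obstruction:
  obtains c F where "valid c" "F \<subseteq> E" "E - F \<subseteq> coloured c"
    and "\<And>e i. e \<in> F \<Longrightarrow> i < N \<Longrightarrow>
      \<exists>T\<subseteq>V. e \<subseteq> T \<and> tight (l i) (colour_class c i \<inter> F) T"
proof -
  obtain c where opt: "optimal c" using optimal_exists by blast
  have "\<exists>T\<subseteq>V. e \<subseteq> T \<and> tight (l i) (colour_class c i \<inter> freeable c) T"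
    if e: "e \<in> freeable c" and i: "i < N" for e i
  proof -
    obtain c' where c': "exchange\<^sup>*\<^sup>* c c'" "e \<in> E" "N \<le> c' e" using e unfolding freeable_def by auto
    obtain T where T: "T \<subseteq> V" "e \<subseteq> T" "tight (l i) (colour_class c' i \<inter> freeable c) T"
      using uncoloured_in_tight[OF opt c' i] .
    from tight_reachable_back[OF opt i c'(1) T(1,3)] T(2) show ?thesis by (meson subset_trans)
  qed
  moreover have "E - freeable c \<subseteq> coloured c"
    unfolding freeable_def coloured_def by (auto simp: not_less)
  moreover have "freeable c \<subseteq> E" unfolding freeable_def by auto
  ultimately show ?thesis using that[of c "freeable c"] opt unfolding optimal_def by blast
qed

end

section \<open>Counting edges\<close>

text \<open>Every edge counted on the left belongs to \<open>D\<close> and is charged to its only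
  end in \<open>I\<close>.\<close>

lemma cut_le_sum_degree:
  fixes E D :: "'a set set"
  assumes "finite E" "finite I" "D \<subseteq> E"
    and "\<And>e. e \<in> E \<Longrightarrow> e \<inter> B = {} \<Longrightarrow> card (e \<inter> I) = 1 \<Longrightarrow> e \<in> D"
  shows "card {e \<in> E. e \<inter> B = {} \<and> card (e \<inter> I) = 1} \<le> (\<Sum>v\<in>I. card {e \<in> D. v \<in> e})"
proof -
  have "{e \<in> E. e \<inter> B = {} \<and> card (e \<inter> I) = 1} \<subseteq> (\<Union>v\<in>I. {e \<in> D. v \<in> e})"
  proof
    fix e assume e: "e \<in> {e \<in> E. e \<inter> B = {} \<and> card (e \<inter> I) = 1}"
    then obtain v where "e \<inter> I = {v}" by (auto simp: card_1_singleton_iff)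
    then show "e \<in> (\<Union>v\<in>I. {e \<in> D. v \<in> e})" using e assms(4) by auto
  qed
  then have "card {e \<in> E. e \<inter> B = {} \<and> card (e \<inter> I) = 1} \<le> card (\<Union>v\<in>I. {e \<in> D. v \<in> e})"
    by (rule card_mono[rotated]) (use assms finite_subset[OF assms(3)] in auto)
  also have "\<dots> \<le> (\<Sum>v\<in>I. card {e \<in> D. v \<in> e})" by (rule card_UN_le) (use assms in auto)
  finally show ?thesis .
qed

text \<open>The integer \<open>q\<close> stands for \<open>p\<close>, and \<open>conn\<close> is the
  connectivity hypothesis with vertex deletion unfolded. Two vertices are required so that a single
  vertex is a proper subset of \<open>V\<close>.\<close>

locale connected_graph =
  fixes V :: "'a set" and E :: "'a set set" and l :: "'a set \<Rightarrow> int" and q k :: int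
  assumes finV: "finite V" and V2: "2 \<le> card V"
    and edgeE: "\<And>e. e \<in> E \<Longrightarrow> e \<subseteq> V \<and> card e = 2"
    and l_nonneg: "\<And>X. X \<subseteq> V \<Longrightarrow> 0 \<le> l X"
    and l_antimono: "\<And>X Y. X \<noteq> {} \<Longrightarrow> X \<subseteq> Y \<Longrightarrow> Y \<subseteq> V \<Longrightarrow> l Y \<le> l X"
    and q: "1 \<le> q" and k: "2 \<le> k"
    and conn: "\<And>A B. A \<subseteq> V \<Longrightarrow> B \<subseteq> V \<Longrightarrow> A \<inter> B = {} \<Longrightarrow> A \<noteq> {} \<Longrightarrow> A \<union> B \<noteq> V \<Longrightarrow>
      4 * k * q - 2 * q + 2 * l (A \<union> B) - int (card B)
        \<le> int (card {e \<in> E. e \<inter> B = {} \<and> card (e \<inter> A) = 1})"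
begin

lemma finite_E: "finite E"
  by (rule finite_subset[of _ "Pow V"]) (use finV edgeE in auto)

text \<open>The contribution of one part \<open>A\<close>, doubled because degree sums over all
  parts count each edge of \<open>D\<close> twice. Vertices are sorted by the number of members of
  \<open>H\<close> containing them: none (\<open>L\<close>), one (\<open>U\<close>) or more
  (\<open>M\<close>). Each vertex of \<open>L\<close> and each member of \<open>H\<close> has a
  nonnegative balance, and if \<open>A \<noteq> V\<close> one of the terms also pays for
  \<open>2 * l A\<close>.\<close>

lemma part_bound:
  assumes A: "A \<subseteq> V" "A \<noteq> {}" and D: "D \<subseteq> E"
    and H: "\<And>X. X \<in> H \<Longrightarrow> X \<subseteq> A \<and> 2 * k \<le> int (card X) \<and> X \<noteq> V"
    and cover: "\<And>e. e \<in> E - D \<Longrightarrow> e \<inter> A \<noteq> {} \<Longrightarrow> \<exists>X\<in>H. e \<subseteq> X"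
  shows "2 * q * k * int (card A) + 2 * (if A = V then 0 else l A)
    \<le> (\<Sum>v\<in>A. int (card {e \<in> D. v \<in> e})) + (\<Sum>X\<in>H. 2 * q * (k * int (card X) - (2 * k - 1)))"
proof -
  define m where "m = (if A = V then 0 else l A)"
  define w where "w v = int (card {e \<in> D. v \<in> e})" for v
  define t where "t v = card {X \<in> H. v \<in> X}" for v
  define L where "L = {v \<in> A. t v = 0}"
  define U where "U = {v \<in> A. t v = 1}"
  define M where "M = {v \<in> A. 2 \<le> t v}"
  \<comment> \<open>The balance of \<open>X\<close>: its private vertices bring their degrees in
    \<open>D\<close>, each shared vertex is worth \<open>q * k\<close>, and the constant term of the
    bound is subtracted.\<close>
  define qX where "qX X = (\<Sum>v\<in>X \<inter> U. w v) + q * k * int (card (X \<inter> M)) - 2 * q * (2 * k - 1)" for X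
  have finA: "finite A" using A finV finite_subset by blast
  have finH: "finite H" by (rule finite_subset[of _ "Pow A"]) (use H finA in auto)
  have qk: "2 \<le> q * k" using mult_mono[of 1 q 2 k] q k by simp
  have m_le: "m \<le> l X" if "X \<noteq> {}" "X \<subseteq> A" for X
    using that A l_antimono[of X A] l_nonneg[of X] unfolding m_def by auto
  have m0: "0 \<le> m" using l_nonneg A unfolding m_def by auto
  have w0: "0 \<le> w v" for v unfolding w_def by simp
  have A_split: "A = L \<union> U \<union> M" "L \<inter> U = {}" "(L \<union> U) \<inter> M = {}"
    unfolding L_def U_def M_def by auto
  have fin: "finite L" "finite U" "finite M" using A_split finA by (metis finite_Un)+
  have sumA: "(\<Sum>v\<in>A. g v) = (\<Sum>v\<in>L. g v) + (\<Sum>v\<in>U. g v) + (\<Sum>v\<in>M. g v)" for g :: "'a \<Rightarrow> int"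
    using A_split fin by (simp add: sum.union_disjoint)
  \<comment> \<open>No member covers \<open>v\<close>, so all edges at \<open>v\<close> belong to
    \<open>D\<close>, and connectivity with nothing deleted bounds its degree.\<close>
  have lonely: "2 * q * k + 2 * l {v} \<le> w v" if v: "v \<in> L" for v
  proof -
    have vV: "v \<in> V" using v A L_def by auto
    have "{v} \<noteq> V" using V2 by auto
    then have "4 * k * q - 2 * q + 2 * l {v} \<le> int (card {e \<in> E. e \<inter> {} = {} \<and> card (e \<inter> {v}) = 1})"
      using conn[of "{v}" "{}"] vV by simp
    also have "\<dots> \<le> int (\<Sum>u\<in>{v}. card {e \<in> D. u \<in> e})"
    proof (intro iffD2[OF of_nat_le_iff] cut_le_sum_degree)
      fix e assume e: "e \<in> E" "card (e \<inter> {v}) = 1"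
      then have ve: "v \<in> e" by (cases "v \<in> e") auto
      show "e \<in> D"
      proof (rule ccontr)
        assume "e \<notin> D"
        then obtain X where "X \<in> H" "e \<subseteq> X" using cover e ve v unfolding L_def by blast
        then have "{X \<in> H. v \<in> X} \<noteq> {}" using ve by auto
        then show False using v finH unfolding L_def t_def by auto
      qed
    qed (use finite_E D in auto)
    finally have "4 * k * q - 2 * q + 2 * l {v} \<le> w v" unfolding w_def by simp
    moreover have "2 * q \<le> 2 * (q * k)" using mult_left_mono[of 1 k q] q k by simp
    ultimately show ?thesis by (simp add: algebra_simps)
  qed
  have XU_M: "X = (X \<inter> U) \<union> (X \<inter> M)" if X: "X \<in> H" for X
  proof -
    have "t v \<noteq> 0" if "v \<in> X" for v
      using X that finH unfolding t_def by auto
    then show ?thesis using H[OF X] unfolding U_def M_def by force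
  qed
  \<comment> \<open>Connectivity is applied to \<open>X \<inter> U\<close> after deleting
    \<open>X \<inter> M\<close>. The term \<open>4 * k * q - 2 * q\<close> cancels the constant of
    \<open>qX X\<close> exactly, and the loss of \<open>card (X \<inter> M)\<close> is covered
    because \<open>1 \<le> q * k\<close>.\<close>
  have qX_inner: "2 * l X \<le> qX X" if X: "X \<in> H" "X \<inter> U \<noteq> {}" for X
  proof -
    have XV: "X \<subseteq> V" "X \<noteq> V" using H X A by auto
    have "4 * k * q - 2 * q + 2 * l X - int (card (X \<inter> M))
        \<le> int (card {e \<in> E. e \<inter> (X \<inter> M) = {} \<and> card (e \<inter> (X \<inter> U)) = 1})"
      using conn[of "X \<inter> U" "X \<inter> M"] X XV XU_M[OF X(1)] A_split by auto
    also have "\<dots> \<le> int (\<Sum>u\<in>X \<inter> U. card {e \<in> D. u \<in> e})"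
    proof (intro iffD2[OF of_nat_le_iff] cut_le_sum_degree)
      fix e assume e: "e \<in> E" "e \<inter> (X \<inter> M) = {}" "card (e \<inter> (X \<inter> U)) = 1"
      then obtain u where u: "e \<inter> (X \<inter> U) = {u}" by (auto simp: card_1_singleton_iff)
      \<comment> \<open>An edge outside \<open>D\<close> lies in a member, and at the private vertex
        \<open>u\<close> this can only be \<open>X\<close>. Avoiding \<open>X \<inter> M\<close>, it
        would have both ends in \<open>X \<inter> U\<close>.\<close>
      show "e \<in> D"
      proof (rule ccontr)
        assume "e \<notin> D"
        moreover have "u \<in> A" using u unfolding U_def by auto
        ultimately obtain Y where Y: "Y \<in> H" "e \<subseteq> Y" using cover e u by blast
        have "card {X \<in> H. u \<in> X} = 1" using u unfolding U_def t_def by auto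
        then obtain Z where Z: "{X \<in> H. u \<in> X} = {Z}" by (auto simp: card_1_singleton_iff)
        moreover have "X \<in> {X \<in> H. u \<in> X}" "Y \<in> {X \<in> H. u \<in> X}" using X Y u by auto
        ultimately have "X = Y" by auto
        then have "e \<subseteq> X \<inter> U" using Y XU_M[OF X(1)] e by auto
        then have "e = {u}" using u by auto
        then show False using edgeE[OF e(1)] by simp
      qed
    qed (use finite_E D fin in auto)
    finally have "4 * k * q - 2 * q + 2 * l X - int (card (X \<inter> M)) \<le> (\<Sum>u\<in>X \<inter> U. w u)"
      unfolding w_def by simp
    moreover have "int (card (X \<inter> M)) \<le> q * k * int (card (X \<inter> M))"
      using mult_right_mono[of 1 "q * k" "int (card (X \<inter> M))"] qk by simp
    ultimately show ?thesis unfolding qX_def by (simp add: algebra_simps)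
  qed
  have qX0: "0 \<le> qX X" if X: "X \<in> H" for X
  proof (cases "X \<inter> U = {}")
    case False
    then show ?thesis using qX_inner[OF X] l_nonneg[of X] H[OF X] A by force
  next
    \<comment> \<open>Without private vertices the lower bound \<open>2 * k\<close> on the size of
      \<open>X\<close> decides: \<open>k * (2 * k) \<ge> 2 * (2 * k - 1)\<close> since
      \<open>(k - 1) * (k - 1) \<ge> 0\<close>.\<close>
    case True
    then have XM: "X \<inter> M = X" using XU_M[OF X] by auto
    have "0 \<le> (k - 1) * (k - 1)" by simp
    then have "2 * (2 * k - 1) \<le> k * (2 * k)" by (simp add: algebra_simps)
    also have "\<dots> \<le> k * int (card X)" using H[OF X] k by (intro mult_left_mono) auto
    finally have "q * (2 * (2 * k - 1)) \<le> q * (k * int (card X))" using q by (intro mult_left_mono) auto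
    then show ?thesis unfolding qX_def True XM by (simp add: algebra_simps)
  qed
  have U_UN: "U = (\<Union>X\<in>H. X \<inter> U)"
  proof
    show "U \<subseteq> (\<Union>X\<in>H. X \<inter> U)"
    proof
      fix u assume u: "u \<in> U"
      then have "card {X \<in> H. u \<in> X} = 1" unfolding U_def t_def by auto
      then have "{X \<in> H. u \<in> X} \<noteq> {}" by (metis card.empty zero_neq_one)
      then show "u \<in> (\<Union>X\<in>H. X \<inter> U)" using u by auto
    qed
  qed auto
  have sumU: "(\<Sum>v\<in>U. w v) = (\<Sum>X\<in>H. \<Sum>v\<in>X \<inter> U. w v)"
  proof (subst U_UN, rule sum.UNION_disjoint)
    show "\<forall>X\<in>H. \<forall>Y\<in>H. X \<noteq> Y \<longrightarrow> X \<inter> U \<inter> (Y \<inter> U) = {}"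
    proof (intro ballI impI, rule ccontr)
      fix X Y assume XY: "X \<in> H" "Y \<in> H" "X \<noteq> Y" "X \<inter> U \<inter> (Y \<inter> U) \<noteq> {}"
      then obtain u where u: "u \<in> X" "u \<in> Y" "u \<in> U" by auto
      then have "card {X \<in> H. u \<in> X} = 1" unfolding U_def t_def by auto
      then obtain Z where "{X \<in> H. u \<in> X} = {Z}" by (auto simp: card_1_singleton_iff)
      then have "X = Z" "Y = Z" using u XY by auto
      then show False using XY by auto
    qed
  qed (use finH fin in auto)
  have "(\<Sum>v\<in>A. t v) = (\<Sum>X\<in>H. card X)"
    unfolding t_def
  proof (rule sum_multicount_gen)
    show "\<forall>X\<in>H. card {v \<in> A. v \<in> X} = card X"
      using H by (auto intro!: arg_cong[where f = card])
  qed (use finA finH in auto)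
  moreover have "(\<Sum>v\<in>M. t v) = (\<Sum>X\<in>H. card (X \<inter> M))"
    unfolding t_def
  proof (rule sum_multicount_gen)
    show "\<forall>X\<in>H. card {v \<in> M. v \<in> X} = card (X \<inter> M)"
      by (auto intro!: arg_cong[where f = card])
  qed (use fin finH in auto)
  \<comment> \<open>Vertices of \<open>U\<close> have \<open>t v = 1\<close>, and those of
    \<open>M\<close> satisfy \<open>2 + t v \<le> 2 * t v\<close>. This gives up half of the
    incidences at \<open>M\<close>, which pay for the shared vertices in \<open>qX\<close>.\<close>
  moreover have "2 * int (card U) + 2 * int (card M) + (\<Sum>v\<in>M. int (t v)) \<le> 2 * (\<Sum>v\<in>A. int (t v))"
  proof -
    have "(\<Sum>v\<in>L. int (t v)) = 0" "(\<Sum>v\<in>U. int (t v)) = int (card U)"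
      unfolding L_def U_def by auto
    moreover have "(\<Sum>v\<in>M. 2 + int (t v)) \<le> (\<Sum>v\<in>M. 2 * int (t v))"
      by (rule sum_mono) (auto simp: M_def)
    ultimately show ?thesis unfolding sumA
      by (simp add: sum.distrib sum_distrib_left)
  qed
  ultimately have count: "2 * int (card U) + 2 * int (card M) + (\<Sum>X\<in>H. int (card (X \<inter> M)))
      \<le> 2 * (\<Sum>X\<in>H. int (card X))"
    by (metis of_nat_sum)
  have main: "2 * m \<le> (\<Sum>v\<in>L. w v - 2 * q * k) + (\<Sum>X\<in>H. qX X) + (\<Sum>v\<in>M. w v)"
  proof -
    have L0: "0 \<le> w v - 2 * q * k" if "v \<in> L" for v
      using lonely[OF that] l_nonneg[of "{v}"] that A unfolding L_def by auto
    then have sL: "0 \<le> (\<Sum>v\<in>L. w v - 2 * q * k)" by (intro sum_nonneg)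
    have sH: "0 \<le> (\<Sum>X\<in>H. qX X)" using qX0 by (intro sum_nonneg)
    have sM: "0 \<le> (\<Sum>v\<in>M. w v)" using w0 by (intro sum_nonneg)
    \<comment> \<open>The amount \<open>2 * m\<close> comes from an uncovered vertex, from a member
      with a private vertex, or, if \<open>A = M\<close>, from the edges leaving \<open>A\<close>;
      in the last case \<open>m\<close> is 0 when \<open>A = V\<close>.\<close>
    consider (l) v where "v \<in> L" | (u) X where "X \<in> H" "X \<inter> U \<noteq> {}" | (m) "L = {}" "U = {}"
      using U_UN by blast
    then show ?thesis
    proof cases
      case l
      have "2 * m \<le> 2 * l {v}" using m_le[of "{v}"] l unfolding L_def by auto
      also have "\<dots> \<le> w v - 2 * q * k" using lonely[OF l] by simp
      also have "\<dots> \<le> (\<Sum>v\<in>L. w v - 2 * q * k)"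
        using member_le_sum[of v L "\<lambda>v. w v - 2 * q * k"] l L0 fin by auto
      finally show ?thesis using sH sM by simp
    next
      case u
      have "2 * m \<le> 2 * l X" using m_le[of X] u H by auto
      also have "\<dots> \<le> qX X" using qX_inner u by auto
      also have "\<dots> \<le> (\<Sum>X\<in>H. qX X)"
        using member_le_sum[of X H qX] u qX0 finH by auto
      finally show ?thesis using sL sM by simp
    next
      case m
      then have AM: "M = A" using A_split by auto
      show ?thesis
      proof (cases "A = V")
        case True
        then show ?thesis using sL sH sM unfolding m_def by simp
      next
        case False
        then have "4 * k * q - 2 * q + 2 * l A \<le> int (card {e \<in> E. e \<inter> {} = {} \<and> card (e \<inter> A) = 1})"
          using conn[of A "{}"] A by simp
        also have "\<dots> \<le> int (\<Sum>u\<in>A. card {e \<in> D. u \<in> e})"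
        proof (intro iffD2[OF of_nat_le_iff] cut_le_sum_degree)
          fix e assume e: "e \<in> E" "card (e \<inter> A) = 1"
          \<comment> \<open>Members of \<open>H\<close> lie inside \<open>A\<close>, so none of them
            contains an edge that leaves \<open>A\<close>.\<close>
          show "e \<in> D"
          proof (rule ccontr)
            assume "e \<notin> D"
            moreover have "e \<inter> A \<noteq> {}" using e by auto
            ultimately obtain X where "X \<in> H" "e \<subseteq> X" using cover e by blast
            then have "e \<inter> A = e" using H by auto
            then show False using e edgeE by auto
          qed
        qed (use finite_E D finA in auto)
        finally have "4 * k * q - 2 * q + 2 * l A \<le> (\<Sum>v\<in>M. w v)" unfolding w_def AM by simp
        moreover have "2 * q \<le> 4 * (q * k)" using mult_left_mono[of 1 k q] q k by simp
        ultimately show ?thesis using sL sH False unfolding m_def by (simp add: algebra_simps)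
      qed
    qed
  qed
  have "(\<Sum>v\<in>L. w v - 2 * q * k) = (\<Sum>v\<in>L. w v) - 2 * q * k * int (card L)"
    by (simp add: sum_subtractf)
  moreover have "(\<Sum>X\<in>H. qX X) = (\<Sum>v\<in>U. w v) + q * k * (\<Sum>X\<in>H. int (card (X \<inter> M)))
      - 2 * q * (2 * k - 1) * int (card H)"
    unfolding qX_def sumU by (simp add: sum_subtractf sum.distrib sum_distrib_left)
  moreover have "q * k * (2 * int (card U) + 2 * int (card M) + (\<Sum>X\<in>H. int (card (X \<inter> M))))
      \<le> q * k * (2 * (\<Sum>X\<in>H. int (card X)))"
    using count qk by (intro mult_left_mono) auto
  moreover have "(\<Sum>X\<in>H. 2 * q * (k * int (card X) - (2 * k - 1)))
      = 2 * q * k * (\<Sum>X\<in>H. int (card X)) - 2 * q * (2 * k - 1) * int (card H)"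
    by (simp add: sum_subtractf sum.distrib sum_distrib_left algebra_simps)
  moreover have "int (card A) = int (card L) + int (card U) + int (card M)"
    using sumA[of "\<lambda>_. 1"] by simp
  ultimately show ?thesis
    using main sumA[of w] unfolding m_def[symmetric] w_def[symmetric] by (simp add: algebra_simps)
qed


text \<open>The bounds of \<open>part_bound\<close> are added over the parts and halved; each member
  of \<open>H\<close> lies in exactly one part. If \<open>V\<close> is itself a member,
  \<open>part_bound\<close> does not apply, but then \<open>P = {V}\<close> and the term of
  \<open>V\<close> alone suffices.\<close>

lemma partition_bound:
  assumes P: "partition_on V P" and D: "D \<subseteq> E"
    and H: "\<And>X. X \<in> H \<Longrightarrow> 2 * k \<le> int (card X) \<and> (\<exists>A\<in>P. X \<subseteq> A)"
    and cover: "\<And>e. e \<in> E - D \<Longrightarrow> \<exists>X\<in>H. e \<subseteq> X"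
  shows "q * (k * int (card V) - (2 * k - 1)) + (\<Sum>A\<in>P. l A) - l V
    \<le> q * (\<Sum>X\<in>H. k * int (card X) - (2 * k - 1)) + int (card D)"
proof -
  have PA: "A \<noteq> {}" "A \<subseteq> V" if "A \<in> P" for A
    using P that unfolding partition_on_def by auto
  have UP: "\<Union>P = V" using P unfolding partition_on_def by auto
  have disjP: "A = A'" if "A \<in> P" "A' \<in> P" "A \<inter> A' \<noteq> {}" for A A'
    using P that unfolding partition_on_def disjoint_def by blast
  have finP: "finite P" using finite_elements[OF finV P] .
  have P_V: "P = {V}" if "V \<in> P"
  proof -
    have "A = V" if "A \<in> P" for A
    proof -
      have "V \<inter> A \<noteq> {}" using PA[OF that] by auto
      then show ?thesis using disjP[OF \<open>V \<in> P\<close> that] by simp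
    qed
    then show ?thesis using \<open>V \<in> P\<close> by blast
  qed
  have HV: "X \<subseteq> V" if "X \<in> H" for X using H[OF that] PA by blast
  have Hne: "X \<noteq> {}" if "X \<in> H" for X using H[OF that] k by auto
  have finH: "finite H" by (rule finite_subset[of _ "Pow V"]) (use HV finV in auto)
  have pos: "0 \<le> k * int (card X) - (2 * k - 1)" if "X \<in> H" for X
  proof -
    have "k * 2 \<le> k * int (card X)" using H[OF that] k by (intro mult_left_mono) auto
    then show ?thesis by simp
  qed
  show ?thesis
  proof (cases "V \<in> H")
    case True
    then have "V \<in> P" using H PA by (metis subset_antisym)
    then have "(\<Sum>A\<in>P. l A) = l V" using P_V by simp
    moreover have "k * int (card V) - (2 * k - 1) \<le> (\<Sum>X\<in>H. k * int (card X) - (2 * k - 1))"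
      using member_le_sum[of V H "\<lambda>X. k * int (card X) - (2 * k - 1)"] True pos finH by auto
    then have "q * (k * int (card V) - (2 * k - 1)) \<le> q * (\<Sum>X\<in>H. k * int (card X) - (2 * k - 1))"
      using q by (intro mult_left_mono) auto
    ultimately show ?thesis by simp
  next
    case False
    define h where "h X = 2 * q * (k * int (card X) - (2 * k - 1))" for X :: "'a set"
    let ?HA = "\<lambda>A. {X \<in> H. X \<subseteq> A}"
    let ?m = "\<lambda>A. if A = V then 0 else l A"
    have "(\<Sum>A\<in>P. 2 * q * k * int (card A) + 2 * ?m A)
        \<le> (\<Sum>A\<in>P. (\<Sum>v\<in>A. int (card {e \<in> D. v \<in> e})) + (\<Sum>X\<in>?HA A. h X))"
      unfolding h_def
    proof (intro sum_mono part_bound)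
      fix A e assume A: "A \<in> P" and e: "e \<in> E - D" "e \<inter> A \<noteq> {}"
      obtain X where X: "X \<in> H" "e \<subseteq> X" using cover[OF e(1)] by blast
      moreover obtain A' where A': "A' \<in> P" "X \<subseteq> A'" using H[OF X(1)] by blast
      moreover have "A = A'" using disjP[OF A A'(1)] e X A' by blast
      ultimately show "\<exists>X\<in>?HA A. e \<subseteq> X" by blast
    qed (use PA D H False in auto)
    moreover have "(\<Sum>A\<in>P. 2 * q * k * int (card A) + 2 * ?m A)
        = 2 * q * k * int (card V) + 2 * (\<Sum>A\<in>P. ?m A)"
    proof -
      have "card V = (\<Sum>A\<in>P. card A)"
      proof -
        have "card (\<Union>P) = (\<Sum>A\<in>P. card A)"
        proof (rule card_Union_disjoint)
          show "pairwise disjnt P" using disjP unfolding pairwise_def disjnt_def by metis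
          show "finite A" if "A \<in> P" for A using finite_subset[OF PA(2)[OF that] finV] .
        qed
        then show ?thesis using UP by simp
      qed
      then show ?thesis by (simp add: sum.distrib sum_distrib_left)
    qed
    moreover have "(\<Sum>A\<in>P. \<Sum>v\<in>A. int (card {e \<in> D. v \<in> e})) = 2 * int (card D)"
    proof -
      have "(\<Sum>A\<in>P. \<Sum>v\<in>A. int (card {e \<in> D. v \<in> e})) = (\<Sum>v\<in>\<Union>P. int (card {e \<in> D. v \<in> e}))"
      proof (subst sum.Union_disjoint)
        show "\<forall>A\<in>P. finite A" using finite_subset[OF PA(2) finV] by blast
        show "\<forall>A\<in>P. \<forall>B\<in>P. A \<noteq> B \<longrightarrow> A \<inter> B = {}" using disjP by metis
      qed simp
      also have "\<dots> = int (\<Sum>v\<in>V. card {e \<in> D. v \<in> e})" using UP by simp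
      also have "(\<Sum>v\<in>V. card {e \<in> D. v \<in> e}) = 2 * card D"
      proof (rule sum_multicount)
        show "\<forall>e\<in>D. card {v \<in> V. v \<in> e} = 2"
        proof
          fix e assume "e \<in> D"
          then have "e \<subseteq> V" "card e = 2" using D edgeE by auto
          moreover from this have "{v \<in> V. v \<in> e} = e" by auto
          ultimately show "card {v \<in> V. v \<in> e} = 2" by simp
        qed
      qed (use finV finite_E D finite_subset in auto)
      finally show ?thesis by simp
    qed
    moreover have "(\<Sum>A\<in>P. \<Sum>X\<in>?HA A. h X) = (\<Sum>X\<in>H. h X)"
    proof -
      have "(\<Sum>A\<in>P. \<Sum>X\<in>?HA A. h X) = (\<Sum>X\<in>(\<Union>A\<in>P. ?HA A). h X)"
      proof (rule sum.UNION_disjoint[symmetric])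
        show "\<forall>A\<in>P. \<forall>A'\<in>P. A \<noteq> A' \<longrightarrow> ?HA A \<inter> ?HA A' = {}"
        proof (intro ballI impI, rule ccontr)
          fix A A' assume A: "A \<in> P" "A' \<in> P" "A \<noteq> A'" "?HA A \<inter> ?HA A' \<noteq> {}"
          then obtain X where "X \<in> H" "X \<subseteq> A" "X \<subseteq> A'" by auto
          then show False using disjP[OF A(1,2)] A(3) Hne by blast
        qed
      qed (use finP finH in auto)
      moreover have "(\<Union>A\<in>P. ?HA A) = H" using H by blast
      ultimately show ?thesis by simp
    qed
    moreover have "(\<Sum>X\<in>H. h X) = 2 * (q * (\<Sum>X\<in>H. k * int (card X) - (2 * k - 1)))"
      unfolding h_def by (simp add: sum_distrib_left mult.assoc)
    ultimately have "2 * q * k * int (card V) + 2 * (\<Sum>A\<in>P. ?m A)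
        \<le> 2 * int (card D) + 2 * (q * (\<Sum>X\<in>H. k * int (card X) - (2 * k - 1)))"
      by (simp add: sum.distrib)
    \<comment> \<open>For \<open>P = {V}\<close> both sides vanish; otherwise no part equals
      \<open>V\<close>, and \<open>l V\<close> is nonnegative.\<close>
    moreover have "(\<Sum>A\<in>P. l A) - l V \<le> (\<Sum>A\<in>P. ?m A)"
    proof (cases "V \<in> P")
      case True
      then show ?thesis using P_V by simp
    next
      case False
      then have "(\<Sum>A\<in>P. ?m A) = (\<Sum>A\<in>P. l A)" by (intro sum.cong) auto
      then show ?thesis using l_nonneg[of V] by simp
    qed
    moreover have "0 \<le> q * (2 * k - 1)" using q k by simp
    ultimately show ?thesis by (simp add: algebra_simps)
  qed
qed

end

section \<open>Excess functions of \<open>ell\<close> and of intersecting supermodular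
  functions\<close>

lemma excess_ell:
  assumes "finite X" "2 \<le> card X"
  shows "excess (ell k m) X = k * int (card X) - m"
  using assms by (auto simp: excess_def ell_def)

lemma excess_small:
  assumes "l {} = 0" "finite X" "card X \<le> 1"
  shows "excess l X = 0"
proof (cases "X = {}")
  case False
  then have "card X = 1" using assms(2,3) by (simp add: Suc_leI card_gt_0_iff le_antisym)
  then show ?thesis by (auto simp: excess_def card_1_singleton_iff)
qed (simp add: excess_def assms)

lemma ell_empty: "ell k m {} = 0"
  by (simp add: ell_def)

lemma excess_ell_nonneg:
  assumes "finite X" "1 \<le> k"
  shows "0 \<le> excess (ell k (2 * k - 1)) X"
proof (cases "2 \<le> card X")
  case True
  have "k * 2 \<le> k * int (card X)" using True assms by (intro mult_left_mono) auto
  then show ?thesis using excess_ell[OF assms(1) True] by simp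
qed (use excess_small[of "ell k (2 * k - 1)" X] assms(1) in \<open>auto simp: ell_empty\<close>)

text \<open>On sets with at least two vertices the excess is affine in the cardinality, so
  submodularity holds with equality.\<close>

lemma excess_ell_modular:
  assumes "finite X" "finite Y" "2 \<le> card (X \<inter> Y)"
  shows "excess (ell k m) (X \<inter> Y) + excess (ell k m) (X \<union> Y) = excess (ell k m) X + excess (ell k m) Y"
proof -
  have "card (X \<inter> Y) \<le> card X" "card (X \<inter> Y) \<le> card Y" "card (X \<inter> Y) \<le> card (X \<union> Y)"
    using assms by (auto intro: card_mono)
  moreover have "int (card X) + int (card Y) = int (card (X \<inter> Y)) + int (card (X \<union> Y))"
    using card_Un_Int[OF assms(1,2)] by simp
  then have "k * int (card X) + k * int (card Y) = k * int (card (X \<inter> Y)) + k * int (card (X \<union> Y))"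
    by (metis distrib_left)
  ultimately show ?thesis using assms by (simp add: excess_ell)
qed

lemma excess_submodular:
  assumes "intersecting_supermodular_on V l" "finite V" "X \<subseteq> V" "Y \<subseteq> V" "X \<inter> Y \<noteq> {}"
  shows "excess l (X \<inter> Y) + excess l (X \<union> Y) \<le> excess l X + excess l Y"
proof -
  have "l X + l Y \<le> l (X \<inter> Y) + l (X \<union> Y)"
    using assms unfolding intersecting_supermodular_on_def by blast
  moreover have "(\<Sum>v\<in>X \<union> Y. l {v}) + (\<Sum>v\<in>X \<inter> Y. l {v}) = (\<Sum>v\<in>X. l {v}) + (\<Sum>v\<in>Y. l {v})"
    by (rule sum.union_inter) (use assms finite_subset in auto)
  ultimately show ?thesis unfolding excess_def by simp
qed

text \<open>A single term \<open>l {v}\<close> of the sum already outweighs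
  \<open>l X\<close>.\<close>

lemma excess_nonneg:
  assumes "finite X" "\<And>v. v \<in> X \<Longrightarrow> 0 \<le> l {v}" "\<And>v. v \<in> X \<Longrightarrow> l X \<le> l {v}" "l {} = 0"
  shows "0 \<le> excess l X"
proof (cases "X = {}")
  case False
  then obtain v where v: "v \<in> X" by auto
  have "l {v} \<le> (\<Sum>v\<in>X. l {v})" using member_le_sum[of v X "\<lambda>v. l {v}"] v assms by auto
  then show ?thesis using assms(3)[OF v] unfolding excess_def by simp
qed (use assms in \<open>auto simp: excess_def\<close>)

text \<open>Splitting \<open>X\<close> loses: two nonempty pieces cost at least \<open>2k > 2k - 1\<close>.\<close>

lemma tight_ell_unsplit:
  assumes fin: "finite V" "finite J" and sp: "sparse_edges V (ell k (2 * k - 1)) J" and k: "1 \<le> k"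
    and X: "X \<subseteq> V" "2 \<le> card X" "tight (ell k (2 * k - 1)) J X"
    and Y: "X \<inter> Y \<noteq> {}" and unsplit: "\<And>e. e \<in> J \<Longrightarrow> e \<subseteq> Y \<or> e \<inter> Y = {}"
  shows "X \<subseteq> Y"
proof (rule ccontr)
  assume "\<not> X \<subseteq> Y"
  let ?l = "ell k (2 * k - 1)"
  let ?i = "\<lambda>X. {e \<in> J. e \<subseteq> X}"
  \<comment> \<open>This form of the bound also covers a single vertex, where both sides are
    0.\<close>
  have bound: "excess ?l Z \<le> k * int (card Z) - k" if "finite Z" "Z \<noteq> {}" for Z :: "'a set"
  proof (cases "2 \<le> card Z")
    case True
    then show ?thesis using excess_ell[of Z] that k by simp
  next
    case False
    then have "card Z = 1" using that by (metis One_nat_def Suc_leI card_gt_0_iff le_antisym not_less_eq_eq numeral_2_eq_2)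
    then show ?thesis using excess_small[of ?l Z] that by (simp add: ell_empty)
  qed
  have finX: "finite X" using X fin finite_subset by blast
  have "?i X = ?i (X \<inter> Y) \<union> ?i (X - Y)" using unsplit by blast
  then have "card (?i X) \<le> card (?i (X \<inter> Y)) + card (?i (X - Y))"
    using card_Un_le[of "?i (X \<inter> Y)" "?i (X - Y)"] by simp
  moreover have "int (card (?i (X \<inter> Y))) \<le> excess ?l (X \<inter> Y)" "int (card (?i (X - Y))) \<le> excess ?l (X - Y)"
    using sp X unfolding sparse_edges_def by blast+
  moreover have "excess ?l (X \<inter> Y) \<le> k * int (card (X \<inter> Y)) - k"
    by (rule bound) (use finX Y in auto)
  moreover have "excess ?l (X - Y) \<le> k * int (card (X - Y)) - k"
    by (rule bound) (use finX \<open>\<not> X \<subseteq> Y\<close> in auto)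
  moreover have "card (X \<inter> Y) + card (X - Y) = card X" using finX by (metis card_Int_Diff)
  then have "k * int (card (X \<inter> Y)) + k * int (card (X - Y)) = k * int (card X)"
    by (metis distrib_left of_nat_add)
  ultimately show False using X(3) excess_ell[OF finX X(2), of k "2 * k - 1"] unfolding tight_def by simp
qed

text \<open>Simplicity enters here. With \<open>n = card X\<close> there are at most
  \<open>n * (n - 1) / 2\<close> edges, and the claim reduces to
  \<open>(n - 2) * (n + 1) \<le> (n - 2) * (2 * k)\<close>, which holds as
  \<open>n + 1 \<le> 2 * k\<close>.\<close>

lemma small_set_edges_le:
  fixes k :: int
  assumes X: "finite X" "2 \<le> card X" "int (card X) < 2 * k" and J: "\<And>e. e \<in> J \<Longrightarrow> card e = 2"
  shows "int (card {e \<in> J. e \<subseteq> X}) \<le> k * int (card X) - (2 * k - 1)"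
proof -
  have "card {e \<in> J. e \<subseteq> X} \<le> card {e. e \<subseteq> X \<and> card e = 2}"
    by (rule card_mono) (use X J in auto)
  also have "\<dots> = card X choose 2" by (rule n_subsets[OF X(1)])
  finally have "2 * card {e \<in> J. e \<subseteq> X} \<le> card X * (card X - 1)"
    by (auto simp: choose_two)
  then have "2 * int (card {e \<in> J. e \<subseteq> X}) \<le> int (card X) * (int (card X) - 1)"
  proof -
    have "int (2 * card {e \<in> J. e \<subseteq> X}) \<le> int (card X * (card X - 1))"
      using \<open>2 * card {e \<in> J. e \<subseteq> X} \<le> card X * (card X - 1)\<close> by (rule of_nat_mono)
    also have "\<dots> = int (card X) * (int (card X) - 1)" using X(2) by (simp add: of_nat_diff)
    finally show ?thesis by simp
  qed
  moreover have "(int (card X) - 2) * (int (card X) + 1) \<le> (int (card X) - 2) * (2 * k)"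
    using X by (intro mult_left_mono) auto
  ultimately show ?thesis by (simp add: algebra_simps)
qed

section \<open>Packing\<close>

lemma sum_excess_partition:
  assumes "finite V" "partition_on V P"
  shows "(\<Sum>A\<in>P. excess l A) = (\<Sum>v\<in>V. l {v}) - (\<Sum>A\<in>P. l A)"
proof -
  have UP: "\<Union>P = V" and dis: "disjoint P" using assms(2) unfolding partition_on_def by auto
  have "(\<Sum>v\<in>\<Union>P. l {v}) = (\<Sum>A\<in>P. \<Sum>v\<in>A. l {v})"
  proof (subst sum.Union_disjoint)
    show "\<forall>A\<in>P. finite A" using UP assms(1) by (metis Union_upper finite_subset)
    show "\<forall>A\<in>P. \<forall>B\<in>P. A \<noteq> B \<longrightarrow> A \<inter> B = {}" using dis unfolding disjoint_def by blast
  qed simp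
  then show ?thesis unfolding excess_def using UP by (simp add: sum_subtractf)
qed

text \<open>An edge either crosses or lies inside a part. Sparsity bounds the edges inside the parts
  by the sum of their excesses; subtracting this from \<open>excess l V\<close> cancels the
  singleton values and leaves the required number of crossing edges.\<close>

lemma partition_connected_if_sparse:
  assumes "finite V" and J: "\<And>e. e \<in> J \<Longrightarrow> e \<subseteq> V \<and> card e = 2"
    and sp: "sparse_edges V l J" and card: "int (card J) = excess l V"
  shows "partition_connected l \<lparr>verts = V, edges = J\<rparr>"
  unfolding partition_connected_def
proof (intro allI impI)
  fix P assume "partition_on (verts \<lparr>verts = V, edges = J\<rparr>) P"
  then have P: "partition_on V P" by simp
  have UP: "\<Union>P = V" using P unfolding partition_on_def by auto
  have finP: "finite P" using finite_elements[OF assms(1) P] .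
  have finJ: "finite J" by (rule finite_subset[of _ "Pow V"]) (use J assms(1) in auto)
  define C where "C = {e \<in> J. \<exists>A\<in>P. \<exists>B\<in>P. A \<noteq> B \<and> e \<inter> A \<noteq> {} \<and> e \<inter> B \<noteq> {}}"
  have "J \<subseteq> C \<union> (\<Union>A\<in>P. {e \<in> J. e \<subseteq> A})"
  proof
    fix e assume e: "e \<in> J"
    obtain v where v: "v \<in> e" using J[OF e] by fastforce
    then obtain A where A: "A \<in> P" "v \<in> A" using J[OF e] UP by blast
    show "e \<in> C \<union> (\<Union>A\<in>P. {e \<in> J. e \<subseteq> A})"
    proof (cases "e \<subseteq> A")
      case False
      then obtain u where u: "u \<in> e" "u \<notin> A" by auto
      then obtain B where "B \<in> P" "u \<in> B" using J[OF e] UP by blast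
      then have "e \<in> C" unfolding C_def using e A u v by blast
      then show ?thesis by simp
    qed (use A e in auto)
  qed
  then have "card J \<le> card (C \<union> (\<Union>A\<in>P. {e \<in> J. e \<subseteq> A}))"
    by (rule card_mono[rotated]) (use finJ finP in \<open>auto simp: C_def\<close>)
  also have "\<dots> \<le> card C + card (\<Union>A\<in>P. {e \<in> J. e \<subseteq> A})" by (rule card_Un_le)
  also have "card (\<Union>A\<in>P. {e \<in> J. e \<subseteq> A}) \<le> (\<Sum>A\<in>P. card {e \<in> J. e \<subseteq> A})"
    using finP by (rule card_UN_le)
  finally have "int (card J) \<le> int (card C) + (\<Sum>A\<in>P. int (card {e \<in> J. e \<subseteq> A}))"
    by (simp flip: of_nat_sum of_nat_add)
  also have "(\<Sum>A\<in>P. int (card {e \<in> J. e \<subseteq> A})) \<le> (\<Sum>A\<in>P. excess l A)"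
  proof (rule sum_mono)
    fix A assume "A \<in> P"
    then have "A \<subseteq> V" using UP by auto
    then show "int (card {e \<in> J. e \<subseteq> A}) \<le> excess l A" using sp unfolding sparse_edges_def by blast
  qed
  also have "\<dots> = (\<Sum>v\<in>V. l {v}) - (\<Sum>A\<in>P. l A)" using sum_excess_partition[OF assms(1) P] .
  finally have "(\<Sum>A\<in>P. l A) - l V \<le> int (card C)" using card unfolding excess_def by simp
  then show "(\<Sum>A\<in>P. l A) - l (verts \<lparr>verts = V, edges = J\<rparr>) \<le> int (num_edges_across \<lparr>verts = V, edges = J\<rparr> P)"
    unfolding num_edges_across_def C_def by simp
qed

text \<open>Colour 0 belongs to \<open>l\<close>, the colours from 1 to \<open>p\<close> to
  \<open>ell k (2 * k - 1)\<close>. No class exceeds its excess on \<open>V\<close>, so it is enough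
  that the total size reaches the sum of these bounds.\<close>

lemma (in connected_graph) packing_colouring:
  fixes p :: nat and ls :: "nat \<Rightarrow> 'a set \<Rightarrow> int"
  assumes qp: "q = int p" and l0: "l {} = 0" and super: "intersecting_supermodular_on V l"
    and ls: "\<And>i. ls i = (if i = 0 then l else ell k (2 * k - 1))"
  shows "\<exists>c. \<forall>i<Suc p. sparse_edges V (ls i) {e \<in> E. c e = i} \<and>
    int (card {e \<in> E. c e = i}) = excess (ls i) V"
proof -
  interpret S: sparse_colouring V E "Suc p" ls
  proof
    fix i X Y assume XY: "X \<subseteq> V" "Y \<subseteq> V" "2 \<le> card (X \<inter> Y)"
    then have "finite X" "finite Y" "X \<inter> Y \<noteq> {}" using finV finite_subset by auto
    then show "excess (ls i) (X \<inter> Y) + excess (ls i) (X \<union> Y) \<le> excess (ls i) X + excess (ls i) Y"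
      using XY excess_submodular[OF super finV XY(1,2)] excess_ell_modular[of X Y k "2 * k - 1"] ls by simp
  next
    fix i X assume X: "X \<subseteq> V"
    then have "finite X" using finV finite_subset by auto
    moreover have "0 \<le> excess l X"
      by (rule excess_nonneg) (use \<open>finite X\<close> X l0 l_nonneg l_antimono in auto)
    ultimately show "0 \<le> excess (ls i) X" using excess_ell_nonneg[of X k] k ls by simp
  qed (use finV edgeE in auto)
  obtain c F where c: "S.valid c" "F \<subseteq> E" "E - F \<subseteq> S.coloured c"
    and inT: "\<And>e i. e \<in> F \<Longrightarrow> i < Suc p \<Longrightarrow>
      \<exists>T\<subseteq>V. e \<subseteq> T \<and> tight (ls i) (S.colour_class c i \<inter> F) T"
    using S.sparse_packing_obstruction by blast
  define C where "C i = {e \<in> E. c e = i}" for i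
  have CC: "S.colour_class c i = C i" for i unfolding S.colour_class_def C_def ..
  define J where "J i = C i \<inter> F" for i
  have finC: "finite (C i)" "finite (J i)" for i using finite_E unfolding C_def J_def by auto
  have spC: "sparse_edges V (ls i) (C i)" if "i < Suc p" for i
    using c(1) that unfolding S.valid_def CC by blast
  have spJ: "sparse_edges V (ls i) (J i)" if "i < Suc p" for i
    by (rule sparse_edges_mono[OF spC[OF that]]) (use finC J_def in auto)
  have edgeJ: "card e = 2" if "e \<in> J i" for e i using that edgeE unfolding J_def C_def by auto
  have inT: "\<exists>T\<subseteq>V. 2 \<le> card T \<and> e \<subseteq> T \<and> tight (ls i) (J i) T" if e: "e \<in> F" and i: "i < Suc p" for e i
  proof -
    obtain T where T: "T \<subseteq> V" "e \<subseteq> T" "tight (ls i) (J i) T" using inT[OF e i] unfolding J_def CC by blast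
    moreover have "card e \<le> card T" by (rule card_mono) (use T finV finite_subset in auto)
    moreover have "card e = 2" using edgeE e c(2) by blast
    ultimately have "2 \<le> card T" by simp
    then show ?thesis using T by blast
  qed
  obtain P where P: "\<And>X. X \<in> P \<Longrightarrow> X \<subseteq> V \<and> 1 \<le> card X \<and> tight l (J 0) X"
    and Pmax: "\<And>X. X \<subseteq> V \<Longrightarrow> 1 \<le> card X \<Longrightarrow> tight l (J 0) X \<Longrightarrow> \<exists>Y\<in>P. X \<subseteq> Y"
    and Pdisj: "\<And>X Y. X \<in> P \<Longrightarrow> Y \<in> P \<Longrightarrow> X \<noteq> Y \<Longrightarrow> card (X \<inter> Y) < 1"
    and Psum: "(\<Sum>X\<in>P. excess l X) \<le> int (card (J 0))"
  proof (rule maximal_tight_family[of V "J 0" l 1])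
    show "sparse_edges V l (J 0)" using spJ[of 0] ls by simp
    fix X Y assume XY: "X \<subseteq> V" "Y \<subseteq> V" "1 \<le> card (X \<inter> Y)"
    then show "excess l (X \<inter> Y) + excess l (X \<union> Y) \<le> excess l X + excess l Y"
      by (intro excess_submodular[OF super finV]) auto
  qed (use finV finC edgeJ in auto)
  have Pdisj: "X \<inter> Y = {}" if "X \<in> P" "Y \<in> P" "X \<noteq> Y" for X Y
  proof -
    have "finite (X \<inter> Y)" using P[OF that(1)] finV finite_subset by blast
    then show ?thesis using Pdisj[OF that] by simp
  qed
  have partP: "partition_on V P"
    unfolding partition_on_def
  proof (intro conjI)
    show "\<Union>P = V"
    proof
      show "V \<subseteq> \<Union>P"
      proof
        fix v assume v: "v \<in> V"
        \<comment> \<open>A singleton spans no edge and has excess 0, so it is tight; hence the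
          maximal tight sets cover \<open>V\<close>.\<close>
        have "{e \<in> J 0. e \<subseteq> {v}} = {}"
        proof (rule ccontr)
          assume "{e \<in> J 0. e \<subseteq> {v}} \<noteq> {}"
          then obtain e where e: "e \<in> J 0" "e \<subseteq> {v}" by auto
          then have "card e \<le> card {v}" by (intro card_mono) auto
          then show False using edgeJ[OF e(1)] by simp
        qed
        then have "tight l (J 0) {v}" unfolding tight_def excess_def by (simp only: card.empty) simp
        then show "v \<in> \<Union>P" using Pmax[of "{v}"] v by auto
      qed
    qed (use P in auto)
    show "disjoint P" using Pdisj unfolding disjoint_def by blast
    show "{} \<notin> P" using P by force
  qed
  \<comment> \<open>A smallest class inside \<open>F\<close> is chosen so that \<open>q\<close>
    copies of its size can later be replaced by the sizes of the \<open>p\<close> classes.\<close>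
  obtain j where j: "1 \<le> j" "j \<le> p" and jmin: "\<And>i. 1 \<le> i \<Longrightarrow> i \<le> p \<Longrightarrow> card (J j) \<le> card (J i)"
  proof -
    have "1 \<le> (1::nat) \<and> 1 \<le> p" using q qp by simp
    from ex_has_least_nat[of "\<lambda>i. 1 \<le> i \<and> i \<le> p", OF this, of "\<lambda>i. card (J i)"] show ?thesis
      using that by blast
  qed
  let ?ell = "ell k (2 * k - 1) :: 'a set \<Rightarrow> int"
  have lsj: "ls j = ?ell" using ls j by simp
  obtain H0 where H0: "\<And>X. X \<in> H0 \<Longrightarrow> X \<subseteq> V \<and> 2 \<le> card X \<and> tight ?ell (J j) X"
    and H0max: "\<And>X. X \<subseteq> V \<Longrightarrow> 2 \<le> card X \<Longrightarrow> tight ?ell (J j) X \<Longrightarrow> \<exists>Y\<in>H0. X \<subseteq> Y"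
    and H0sum: "(\<Sum>X\<in>H0. excess ?ell X) \<le> int (card (J j))"
  proof (rule maximal_tight_family[of V "J j" ?ell 2])
    show "sparse_edges V ?ell (J j)" using spJ[of j] lsj j by simp
    fix X Y assume XY: "X \<subseteq> V" "Y \<subseteq> V" "2 \<le> card (X \<inter> Y)"
    then show "excess ?ell (X \<inter> Y) + excess ?ell (X \<union> Y) \<le> excess ?ell X + excess ?ell Y"
      using excess_ell_modular[of X Y] finV finite_subset by (metis order_refl)
  qed (use finV finC edgeJ in auto)
  have finH0: "finite H0" by (rule finite_subset[of _ "Pow V"]) (use H0 finV in auto)
  have finX: "finite X" if "X \<in> H0" for X using H0[OF that] finV finite_subset by blast
  let ?h = "\<lambda>X::'a set. k * int (card X) - (2 * k - 1)"
  define H where "H = {X \<in> H0. 2 * k \<le> int (card X)}"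
  \<comment> \<open>Besides the edges outside \<open>F\<close>, this set contains the edges of
    \<open>F\<close> covered only by small members of \<open>H0\<close>.\<close>
  define D where "D = E - {e \<in> F. \<exists>X\<in>H. e \<subseteq> X}"
  \<comment> \<open>Each edge of \<open>J j\<close> is in \<open>F\<close> and so lies in a set
    tight for colour 0, hence inside one part. No edge of \<open>J j\<close> crosses
    \<open>A\<close>, and a set tight for \<open>ell\<close> cannot be split.\<close>
  have hull: "\<exists>A\<in>P. X \<subseteq> A" if X: "X \<in> H0" for X
  proof -
    have "X \<noteq> {}" using H0[OF X] by auto
    then obtain v where v: "v \<in> X" by auto
    then obtain A where A: "A \<in> P" "v \<in> A" using partP H0[OF X] unfolding partition_on_def by blast
    have "X \<subseteq> A"
    proof (rule tight_ell_unsplit[OF finV finC(2)[of j]])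
      show "sparse_edges V ?ell (J j)" using spJ[of j] lsj j by simp
      fix e assume "e \<in> J j"
      then have "e \<in> F" unfolding J_def by auto
      then obtain T where T: "T \<subseteq> V" "2 \<le> card T" "e \<subseteq> T" "tight (ls 0) (J 0) T" using inT[of e 0] by auto
      then obtain B where B: "B \<in> P" "T \<subseteq> B" using Pmax[of T] ls by auto
      show "e \<subseteq> A \<or> e \<inter> A = {}" using Pdisj[OF A(1) B(1)] T B by blast
    qed (use H0[OF X] k v A in auto)
    then show ?thesis using A by blast
  qed
  have "q * ?h V + (\<Sum>A\<in>P. l A) - l V \<le> q * (\<Sum>X\<in>H. ?h X) + int (card D)"
    by (rule partition_bound[OF partP]) (use hull in \<open>auto simp: H_def D_def\<close>)
  \<comment> \<open>Edges of \<open>F\<close> in \<open>D\<close> lie in members with fewer than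
    \<open>2 * k\<close> vertices; each spans at most \<open>?h X\<close> edges, and
    \<open>1 \<le> q\<close> allows the factor \<open>q\<close>.\<close>
  moreover have "int (card D) \<le> int (card (E - F)) + q * (\<Sum>X\<in>H0 - H. ?h X)"
  proof -
    have "D \<subseteq> (E - F) \<union> (\<Union>X\<in>H0 - H. {e \<in> E. e \<subseteq> X})"
    proof
      fix e assume e: "e \<in> D"
      show "e \<in> (E - F) \<union> (\<Union>X\<in>H0 - H. {e \<in> E. e \<subseteq> X})"
      proof (cases "e \<in> F")
        case True
        then obtain T where "T \<subseteq> V" "2 \<le> card T" "e \<subseteq> T" "tight ?ell (J j) T"
          using inT[of e j] j lsj by auto
        then obtain X where X: "X \<in> H0" "e \<subseteq> X" using H0max[of T] by auto
        moreover have "e \<in> E" "X \<notin> H" using e True X unfolding D_def by auto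
        ultimately show ?thesis by auto
      qed (use e D_def in auto)
    qed
    then have "card D \<le> card ((E - F) \<union> (\<Union>X\<in>H0 - H. {e \<in> E. e \<subseteq> X}))"
      by (rule card_mono[rotated]) (use finite_E finH0 in auto)
    also have "\<dots> \<le> card (E - F) + card (\<Union>X\<in>H0 - H. {e \<in> E. e \<subseteq> X})" by (rule card_Un_le)
    also have "card (\<Union>X\<in>H0 - H. {e \<in> E. e \<subseteq> X}) \<le> (\<Sum>X\<in>H0 - H. card {e \<in> E. e \<subseteq> X})"
      by (rule card_UN_le) (use finH0 in auto)
    finally have "int (card D) \<le> int (card (E - F)) + (\<Sum>X\<in>H0 - H. int (card {e \<in> E. e \<subseteq> X}))"
      by (simp flip: of_nat_sum of_nat_add)
    also have "(\<Sum>X\<in>H0 - H. int (card {e \<in> E. e \<subseteq> X})) \<le> (\<Sum>X\<in>H0 - H. q * ?h X)"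
    proof (rule sum_mono)
      fix X assume X: "X \<in> H0 - H"
      have "int (card {e \<in> E. e \<subseteq> X}) \<le> ?h X"
        by (rule small_set_edges_le) (use X finX H0 H_def edgeE in auto)
      moreover from this have "1 * ?h X \<le> q * ?h X" using q by (intro mult_right_mono) auto
      ultimately show "int (card {e \<in> E. e \<subseteq> X}) \<le> q * ?h X" by simp
    qed
    finally show ?thesis by (simp add: sum_distrib_left)
  qed
  moreover have "(\<Sum>X\<in>H0. ?h X) = (\<Sum>X\<in>H0 - H. ?h X) + (\<Sum>X\<in>H. ?h X)"
    by (rule sum.subset_diff) (use finH0 H_def in auto)
  then have "q * (\<Sum>X\<in>H0. ?h X) = q * (\<Sum>X\<in>H0 - H. ?h X) + q * (\<Sum>X\<in>H. ?h X)"
    by (simp only: distrib_left)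
  moreover have "(\<Sum>X\<in>H0. ?h X) = (\<Sum>X\<in>H0. excess ?ell X)"
    by (rule sum.cong) (use H0 finX in \<open>auto simp: excess_ell\<close>)
  then have "q * (\<Sum>X\<in>H0. ?h X) \<le> q * int (card (J j))"
    using H0sum q by (intro mult_left_mono) auto
  moreover have "(\<Sum>A\<in>P. excess l A) = (\<Sum>v\<in>V. l {v}) - (\<Sum>A\<in>P. l A)"
    using sum_excess_partition[OF finV partP] .
  \<comment> \<open>The members dropped from \<open>H0\<close> and those kept recombine to at most
    \<open>q * card (J j)\<close>, and the parts contribute at most
    \<open>card (J 0)\<close>.\<close>
  ultimately have bound: "excess l V + q * ?h V \<le> int (card (J 0)) + q * int (card (J j)) + int (card (E - F))"
    using Psum unfolding excess_def[of l V] by linarith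
  \<comment> \<open>All edges outside \<open>F\<close> are coloured, so the class remainders
    \<open>C i - F\<close> partition \<open>E - F\<close>.\<close>
  have sumC: "(\<Sum>i<Suc p. int (card (C i))) = (\<Sum>i<Suc p. int (card (J i))) + int (card (E - F))"
  proof -
    have "card (C i) = card (J i) + card (C i - F)" for i
      unfolding J_def using card_Int_Diff[OF finC(1)] .
    moreover have "(\<Sum>i<Suc p. card (C i - F)) = card (\<Union>i<Suc p. C i - F)"
      by (rule card_UN_disjoint[symmetric]) (use finC in \<open>auto simp: C_def\<close>)
    moreover have "(\<Union>i<Suc p. C i - F) = E - F"
      using c(3) unfolding C_def S.coloured_def by blast
    ultimately show ?thesis by (simp only: of_nat_add sum.distrib flip: of_nat_sum)
  qed
  have "q * int (card (J j)) = (\<Sum>i<p. int (card (J j)))" using qp by simp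
  also have "\<dots> \<le> (\<Sum>i<p. int (card (J (Suc i))))" by (rule sum_mono) (use jmin in auto)
  finally have "(\<Sum>i<Suc p. int (card (C i))) \<ge> excess l V + q * ?h V"
    using bound sumC unfolding sum.lessThan_Suc_shift[of _ p] by linarith
  moreover have "(\<Sum>i<Suc p. excess (ls i) V) = excess l V + q * ?h V"
    unfolding sum.lessThan_Suc_shift using excess_ell[OF finV V2] ls qp by simp
  ultimately have tot: "(\<Sum>i<Suc p. excess (ls i) V) \<le> (\<Sum>i<Suc p. int (card (C i)))" by simp
  have le: "int (card (C i)) \<le> excess (ls i) V" if "i < Suc p" for i
  proof -
    have "{e \<in> C i. e \<subseteq> V} = C i" using edgeE unfolding C_def by auto
    then show ?thesis using spC[OF that] unfolding sparse_edges_def by (metis order_refl)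
  qed
  have "int (card (C i)) = excess (ls i) V" if i: "i < Suc p" for i
  proof (rule ccontr)
    assume "int (card (C i)) \<noteq> excess (ls i) V"
    then have "int (card (C i)) < excess (ls i) V" using le[OF i] by simp
    then have "(\<Sum>i<Suc p. int (card (C i))) < (\<Sum>i<Suc p. excess (ls i) V)"
      by (intro sum_strict_mono_ex1) (use le i in auto)
    then show False using tot by simp
  qed
  then show ?thesis using spC unfolding C_def by blast
qed

section \<open>From colour classes to edge-disjoint spanning subgraphs\<close>

theorem theorem1p4:
  fixes G :: "'a sgraph" and l :: "'a set \<Rightarrow> int" and p :: nat and k :: int
  assumes "simple_graph G"
    and "l {} = 0"
    and "\<forall>A. A \<subseteq> verts G \<longrightarrow> l A \<ge> 0"
    and "nonincreasing_on (verts G) l"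
    and "intersecting_supermodular_on (verts G) l"
    and "p \<ge> 1" and "k \<ge> 2"
    and "\<forall>A B. A \<subseteq> verts G \<and> B \<subseteq> verts G \<and> A \<inter> B = {} \<and> A \<noteq> {} \<and> A \<union> B \<subset> verts G \<longrightarrow>
           int (cut_degree (delete_verts G B) A)
             \<ge> 4 * k * int p - 2 * int p + 2 * l (A \<union> B) - int (card B)"
  shows "\<exists>(H :: 'a sgraph) (R :: nat \<Rightarrow> 'a sgraph).
           spanning_subgraph H G \<and> partition_connected l H \<and>
           (\<forall>i<p. spanning_subgraph (R i) G \<and> k_rigid k (R i)) \<and>
           (\<forall>i<p. edges H \<inter> edges (R i) = {}) \<and>
           (\<forall>i<p. \<forall>j<p. i \<noteq> j \<longrightarrow> edges (R i) \<inter> edges (R j) = {})"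
proof -
  define V where "V = verts G"
  define E where "E = edges G"
  have finV: "finite V" and edgeE: "\<And>e. e \<in> E \<Longrightarrow> e \<subseteq> V \<and> card e = 2"
    using assms(1) unfolding simple_graph_def V_def E_def by auto
  define ls where "ls i = (if i = (0::nat) then l else ell k (2 * k - 1))" for i
  have "\<exists>c. \<forall>i<Suc p. sparse_edges V (ls i) {e \<in> E. c e = i} \<and>
    int (card {e \<in> E. c e = i}) = excess (ls i) V"
  proof (cases "2 \<le> card V")
    case True
    interpret connected_graph V E l "int p" k
    proof
      fix A B assume AB: "A \<subseteq> V" "B \<subseteq> V" "A \<inter> B = {}" "A \<noteq> {}" "A \<union> B \<noteq> V"
      then have "A \<union> B \<subset> V" by auto
      with AB assms(8) have "4 * k * int p - 2 * int p + 2 * l (A \<union> B) - int (card B)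
          \<le> int (cut_degree (delete_verts G B) A)" unfolding V_def by blast
      also have "cut_degree (delete_verts G B) A = card {e \<in> E. e \<inter> B = {} \<and> card (e \<inter> A) = 1}"
        unfolding cut_degree_def delete_verts_def E_def by (simp add: conj_assoc)
      finally show "4 * k * int p - 2 * int p + 2 * l (A \<union> B) - int (card B)
          \<le> int (card {e \<in> E. e \<inter> B = {} \<and> card (e \<inter> A) = 1})" .
    next
      fix X Y assume "X \<noteq> {}" "X \<subseteq> Y" "Y \<subseteq> V"
      then show "l Y \<le> l X" using assms(4) unfolding nonincreasing_on_def V_def by blast
    qed (use finV edgeE True assms in \<open>auto simp: V_def\<close>)
    show ?thesis by (rule packing_colouring) (use assms in \<open>auto simp: ls_def V_def\<close>)
  next
    \<comment> \<open>With at most one vertex there are no edges and every excess is 0, so any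
      colouring is full.\<close>
    case False
    have "E = {}"
    proof (rule ccontr)
      assume "E \<noteq> {}"
      then obtain e where "e \<in> E" by auto
      then show False using edgeE[of e] card_mono[OF finV, of e] False by simp
    qed
    moreover have "excess (ls i) X = 0" if "X \<subseteq> V" for i X
    proof (rule excess_small)
      show "card X \<le> 1" using card_mono[OF finV that] False by simp
    qed (use finite_subset[OF that finV] assms(2) in \<open>auto simp: ls_def ell_empty\<close>)
    ultimately show ?thesis unfolding sparse_edges_def by simp
  qed
  then obtain c where c: "\<And>i. i < Suc p \<Longrightarrow> sparse_edges V (ls i) {e \<in> E. c e = i}"
      "\<And>i. i < Suc p \<Longrightarrow> int (card {e \<in> E. c e = i}) = excess (ls i) V" by blast
  define R where "R i = \<lparr>verts = V, edges = {e \<in> E. c e = i}\<rparr>" for i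
  have span: "spanning_subgraph (R i) G" for i
    unfolding spanning_subgraph_def R_def V_def E_def by auto
  have "partition_connected l (R 0)"
    unfolding R_def
    by (rule partition_connected_if_sparse[OF finV]) (use c[of 0] edgeE in \<open>auto simp: ls_def\<close>)
  moreover have "k_rigid k (R (Suc i))" if "i < p" for i
  proof -
    \<comment> \<open>The class is sparse and of full size, so it serves as its own witness of
      rigidity.\<close>
    have "spanning_subgraph (R (Suc i)) (R (Suc i))" unfolding spanning_subgraph_def by simp
    moreover have "sparse (ell k (2 * k - 1)) (R (Suc i))"
      using c(1)[of "Suc i"] that
      unfolding sparse_def sparse_edges_def num_edges_within_def excess_def R_def ls_def by simp
    moreover have "int (card (edges (R (Suc i)))) =
        (\<Sum>v\<in>verts (R (Suc i)). ell k (2 * k - 1) {v}) - ell k (2 * k - 1) (verts (R (Suc i)))"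
      using c(2)[of "Suc i"] that unfolding excess_def R_def ls_def by simp
    ultimately show ?thesis unfolding k_rigid_def rigid_def by blast
  qed
  moreover have "edges (R i) \<inter> edges (R j) = {}" if "i \<noteq> j" for i j
    using that unfolding R_def by auto
  ultimately show ?thesis
    using span by (intro exI[of _ "R 0"] exI[of _ "\<lambda>i. R (Suc i)"]) auto
qed

end
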